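(* Let $G$ be a finite abelian group of order $v=km+1$, where $m\ge 2$ and $k>1$ are integers, let $\lambda$ be a positive integer, and let $D_1,\dots,D_m$ partition the nonidentity elements of $G$ into $m$ subsets each of size $k$. Then $\{D_1,\dots,D_m\}$ is a nontrivial near-complete $(v,m,k,\lambda)$-SEDF in $G$ if and only if either (1) $(v,m,k,\lambda)=(v,2,\frac{v-1}{2},\frac{v-1}{4})$ and $v\equiv 1\pmod 4$ and $D_1$ is a nontrivial regular $(v,\frac{v-1}{2},\frac{v-5}{4},\frac{v-1}{4})$-PDS in $G$; or (2) $(v,m,k,\lambda)=(243,11,22,20)$ and each $D_j$ ($1\le j\le 11$) is a nontrivial regular $(243,22,1,2)$-PDS in $G$. Furthermore, a $(243,11,22,20)$-SEDF exists in $\mathbb{Z}_3^5$.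
   Context: Groups are finite abelian, written multiplicatively with identity $1$. For a subset $A\subseteq G$ we also write $A$ for $\sum_{a\in A}a\in\mathbb{Z}[G]$ and $A^{(-1)}=\sum_{a\in A}a^{-1}$. Given integers $m\ge 2$, $k\ge1$, $\lambda\ge 1$ and a group $G$ of order $v$, a collection $\{D_1,\dots,D_m\}$ of mutually disjoint $k$-subsets of $G$ is a $(v,m,k,\lambda)$-strong external difference family (SEDF) in $G$ if $D_j\sum_{i\ne j}D_i^{(-1)}=\lambda(G-1)$ in $\mathbb{Z}[G]$ for each $j$. It is nontrivial if $k>1$, and near-complete if $v=km+1$. A $k$-subset $D$ of a group $G$ of order $v$ with $1\notin D$ is a $(v,k,\lambda',\mu)$ partial difference set (PDS) in $G$ if $DD^{(-1)}=(k-\mu)\cdot1+\lambda' D+\mu(G-D)$ in $\mathbb{Z}[G]$; it is regular if $D=D^{(-1)}$, and trivial if $D\cup\{1\}$ or $G\setminus D$ is a subgroup of $G$. *)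

theory Defs
  imports "HOL-Algebra.Algebra" "HOL-Library.Poly_Mapping" "HOL-Library.Disjoint_Sets"
begin

text \<open>
  Elements of the integral group ring of \<open>G\<close> are finitely supported integer-valued functions
  (type \<open>'a \<Rightarrow>\<^sub>0 int\<close>, with its library addition and \<^const>\<open>frag_cmul\<close> as integer scaling);
  \<open>frag_of x\<close> is the basis element of \<open>x\<close>. The product is written explicitly because
  multiplication on \<open>'a \<Rightarrow>\<^sub>0 int\<close> from the library is convolution over a type class of monoids,
  not over a group record: it is the bilinear extension of the group operation.
\<close>

definition gring_mult ::
    "('a, 'b) monoid_scheme \<Rightarrow> ('a \<Rightarrow>\<^sub>0 int) \<Rightarrow> ('a \<Rightarrow>\<^sub>0 int) \<Rightarrow> ('a \<Rightarrow>\<^sub>0 int)"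
  where "gring_mult G p q = frag_extend (\<lambda>x. frag_extend (\<lambda>y. frag_of (x \<otimes>\<^bsub>G\<^esub> y)) q) p"

lemma gring_mult_frag_of: "gring_mult G (frag_of x) (frag_of y) = frag_of (x \<otimes>\<^bsub>G\<^esub> y)"
  by (simp add: gring_mult_def)

definition set_elt :: "'a set \<Rightarrow> ('a \<Rightarrow>\<^sub>0 int)"
  where "set_elt A = (\<Sum>a\<in>A. frag_of a)"

definition set_inv_elt :: "('a, 'b) monoid_scheme \<Rightarrow> 'a set \<Rightarrow> ('a \<Rightarrow>\<^sub>0 int)"
  where "set_inv_elt G A = (\<Sum>a\<in>A. frag_of (inv\<^bsub>G\<^esub> a))"

text \<open>A family \<open>D\<close> is indexed by \<open>{1..m}\<close>; its values elsewhere are irrelevant.\<close>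

definition sedf ::
    "('a, 'b) monoid_scheme \<Rightarrow> nat \<Rightarrow> nat \<Rightarrow> nat \<Rightarrow> nat \<Rightarrow> (nat \<Rightarrow> 'a set) \<Rightarrow> bool"
  where "sedf G v m k l D \<longleftrightarrow>
    comm_group G \<and> finite (carrier G) \<and> order G = v \<and>
    m \<ge> 2 \<and> k \<ge> 1 \<and> l \<ge> 1 \<and>
    (\<forall>i\<in>{1..m}. D i \<subseteq> carrier G \<and> card (D i) = k) \<and>
    disjoint_family_on D {1..m} \<and>
    (\<forall>j\<in>{1..m}.
      gring_mult G (set_elt (D j)) (\<Sum>i\<in>{1..m} - {j}. set_inv_elt G (D i)) =
      frag_cmul (int l) (set_elt (carrier G) - frag_of \<one>\<^bsub>G\<^esub>))"

definition nontrivial_sedf ::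
    "('a, 'b) monoid_scheme \<Rightarrow> nat \<Rightarrow> nat \<Rightarrow> nat \<Rightarrow> nat \<Rightarrow> (nat \<Rightarrow> 'a set) \<Rightarrow> bool"
  where "nontrivial_sedf G v m k l D \<longleftrightarrow> sedf G v m k l D \<and> k > 1"

definition near_complete_sedf ::
    "('a, 'b) monoid_scheme \<Rightarrow> nat \<Rightarrow> nat \<Rightarrow> nat \<Rightarrow> nat \<Rightarrow> (nat \<Rightarrow> 'a set) \<Rightarrow> bool"
  where "near_complete_sedf G v m k l D \<longleftrightarrow> sedf G v m k l D \<and> v = k * m + 1"

text \<open>In \<open>pds G v k l u D\<close> the parameter \<open>l\<close> is \<open>\<lambda>'\<close> and \<open>u\<close> is \<open>\<mu>\<close>.\<close>

definition pds ::
    "('a, 'b) monoid_scheme \<Rightarrow> nat \<Rightarrow> nat \<Rightarrow> nat \<Rightarrow> nat \<Rightarrow> 'a set \<Rightarrow> bool"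
  where "pds G v k l u D \<longleftrightarrow>
    comm_group G \<and> finite (carrier G) \<and> order G = v \<and>
    D \<subseteq> carrier G \<and> card D = k \<and> \<one>\<^bsub>G\<^esub> \<notin> D \<and>
    gring_mult G (set_elt D) (set_inv_elt G D) =
      frag_cmul (int k - int u) (frag_of \<one>\<^bsub>G\<^esub>) + frag_cmul (int l) (set_elt D)
      + frag_cmul (int u) (set_elt (carrier G) - set_elt D)"

definition regular_pds ::
    "('a, 'b) monoid_scheme \<Rightarrow> nat \<Rightarrow> nat \<Rightarrow> nat \<Rightarrow> nat \<Rightarrow> 'a set \<Rightarrow> bool"
  where "regular_pds G v k l u D \<longleftrightarrow> pds G v k l u D \<and> set_elt D = set_inv_elt G D"

definition trivial_pds_set :: "('a, 'b) monoid_scheme \<Rightarrow> 'a set \<Rightarrow> bool"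
  where "trivial_pds_set G D \<longleftrightarrow> subgroup (D \<union> {\<one>\<^bsub>G\<^esub>}) G \<or> subgroup (carrier G - D) G"

definition nontrivial_regular_pds ::
    "('a, 'b) monoid_scheme \<Rightarrow> nat \<Rightarrow> nat \<Rightarrow> nat \<Rightarrow> nat \<Rightarrow> 'a set \<Rightarrow> bool"
  where "nontrivial_regular_pds G v k l u D \<longleftrightarrow>
    regular_pds G v k l u D \<and> \<not> trivial_pds_set G D"

definition Z3_pow_5 :: "(nat \<Rightarrow> int) monoid"
  where "Z3_pow_5 = product_group {1..5} (\<lambda>_. integer_mod_group 3)"

end

theory Submission
  imports Defs
begin

text \<open>
  Since the \<open>D\<^sub>i\<close> partition \<open>G - 1\<close>, the defining equation for \<open>j\<close> says
  \<open>D\<^sub>j D\<^sub>j\<^sup>-\<^sup>1 = \<lambda> + \<mu> G - D\<^sub>j\<close> with \<open>\<mu> = k - \<lambda>\<close> (\<open>u\<close> below), i.e. \<open>D\<^sub>j\<close> is a regular partial difference set, and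
  counting gives \<open>k = m \<mu>\<close>. A nontrivial character maps each \<open>D\<^sub>j\<close> to \<open>(-1 \<plusminus> \<delta>) / 2\<close> with
  \<open>\<delta>\<^sup>2 = 1 + 4\<lambda>\<close>, and these \<open>m\<close> values add up to \<open>-1\<close>. If \<open>m > 2\<close> this forces \<open>\<delta> = 4\<mu> + 1\<close>,
  \<open>m = 4\<mu> + 3\<close> and \<open>v = (\<mu> + 1) \<delta>\<^sup>2\<close>, and every nontrivial character takes the negative value on
  exactly \<open>2\<mu> + 1\<close> of the sets. Averaging over the characters that are trivial on a subgroup \<open>W\<close>
  expresses \<open>|D\<^sub>j \<inter> W|\<close> through the number of those characters that are negative on \<open>D\<^sub>j\<close>. For suitable
  Hall subgroups \<open>W\<close> this shows first that \<open>\<mu> + 1\<close> is a power of 3 and then that it equals 3.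

  For the existence, the \<open>D\<^sub>j\<close> are the cyclotomic classes of order 11 of \<open>GF(3\<^sup>5)\<close>; the representation
  counts are read off from a table of Zech logarithms.
\<close>

section \<open>Characters of finite abelian groups\<close>

locale finite_comm_group = comm_group +
  assumes finite_carrier [simp]: "finite (carrier G)"
begin

text \<open>Only the values on \<open>H\<close> are constrained, so extending a character changes
  neither the type nor the group record. Nonzero values suffice: on a subgroup, finite order makes
  them roots of unity.\<close>

definition char_on :: "'a set \<Rightarrow> ('a \<Rightarrow> complex) \<Rightarrow> bool"
  where "char_on H \<chi> \<longleftrightarrow> (\<forall>x\<in>H. \<chi> x \<noteq> 0) \<and> (\<forall>x\<in>H. \<forall>y\<in>H. \<chi> (x \<otimes> y) = \<chi> x * \<chi> y)"

lemma char_on_one: "subgroup H G \<Longrightarrow> char_on H \<chi> \<Longrightarrow> \<chi> \<one> = 1"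
  unfolding char_on_def
  by (metis mult_cancel_left1 one_closed r_one subgroup.one_closed)

lemma subgroup_nat_pow: "subgroup H G \<Longrightarrow> x \<in> H \<Longrightarrow> x [^] (n::nat) \<in> H"
  by (induction n) (auto simp: subgroup.one_closed subgroup.m_closed)

lemma char_on_nat_pow:
  assumes "subgroup H G" "char_on H \<chi>" "x \<in> H"
  shows "\<chi> (x [^] (n::nat)) = \<chi> x ^ n"
proof (induction n)
  case 0
  show ?case using char_on_one[OF assms(1,2)] by simp
next
  case (Suc n)
  have "x [^] n \<in> H" using subgroup_nat_pow assms by blast
  then show ?case using Suc assms by (simp add: char_on_def)
qed

text \<open>Adjoin \<open>a\<close> by sending \<open>h \<otimes> a [^] i\<close> to
  \<open>\<chi> h * z ^ i\<close>. This is well defined because every \<open>n\<close> with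
  \<open>a [^] n \<in> H\<close> is a multiple of \<open>r\<close>. The root \<open>z\<close> stays
  free: any choice extends \<open>\<chi>\<close>, and a nontrivial root of unity separates
  points.\<close>

lemma char_extend_step:
  assumes H: "subgroup H G" and \<chi>: "char_on H \<chi>" and a: "a \<in> carrier G"
    and r: "r > 0" "a [^] r \<in> H" and least: "\<And>i. 0 < i \<Longrightarrow> i < r \<Longrightarrow> a [^] i \<notin> H"
    and z: "z ^ r = \<chi> (a [^] (r::nat))"
  shows "\<exists>K \<psi>. subgroup K G \<and> char_on K \<psi> \<and> H \<subseteq> K \<and> a \<in> K \<and> (\<forall>h\<in>H. \<psi> h = \<chi> h) \<and> \<psi> a = z"
proof -
  have Hc: "H \<subseteq> carrier G" using H by (rule subgroup.subset)
  have mul: "\<chi> (x \<otimes> y) = \<chi> x * \<chi> y" if "x \<in> H" "y \<in> H" for x y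
    using \<chi> that by (auto simp: char_on_def)
  have z0: "z \<noteq> 0" using z r \<chi> by (metis char_on_def power_eq_0_iff)
  have pow: "\<chi> (a [^] n) = z ^ n" if n: "a [^] n \<in> H" for n :: nat
  proof -
    \<comment> \<open>Division by \<open>r\<close>: the remainder power lies in \<open>H\<close>, so
      minimality of \<open>r\<close> makes the remainder zero.\<close>
    define q t where "q = n div r" and "t = n mod r"
    have nqt: "n = r * q + t" by (simp add: q_def t_def)
    have rq: "(a [^] r) [^] q \<in> H" using H r(2) by (rule subgroup_nat_pow)
    have e: "a [^] n = (a [^] r) [^] q \<otimes> a [^] t"
      using a by (simp add: nqt nat_pow_mult nat_pow_pow)
    then have "a [^] t = inv ((a [^] r) [^] q) \<otimes> a [^] n"
      using a by (simp add: m_assoc[symmetric])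
    then have "a [^] t \<in> H"
      using H n rq by (simp add: subgroup.m_closed subgroup.m_inv_closed)
    moreover have "t < r" using r by (simp add: t_def)
    ultimately have "t = 0" using least by blast
    then show ?thesis
      using e a nqt char_on_nat_pow[OF H \<chi> r(2), of q] z by (simp add: power_mult)
  qed
  have wd_le: "\<chi> h * z ^ i = \<chi> h' * z ^ j"
    if "h \<in> H" "h' \<in> H" "h \<otimes> a [^] i = h' \<otimes> a [^] j" "i \<le> j" for h h' and i j :: nat
  proof -
    have c: "h \<in> carrier G" "h' \<in> carrier G" using that Hc by auto
    have "h \<otimes> a [^] i = (h' \<otimes> a [^] (j - i)) \<otimes> a [^] i"
      using that a c by (simp add: m_assoc nat_pow_mult)
    then have h: "h = h' \<otimes> a [^] (j - i)" using a c by simp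
    then have "a [^] (j - i) = inv h' \<otimes> h" using a c by (simp add: m_assoc[symmetric])
    then have "a [^] (j - i) \<in> H" using that H by (simp add: subgroup.m_closed subgroup.m_inv_closed)
    then have "\<chi> h = \<chi> h' * z ^ (j - i)" using h mul pow that by metis
    then show ?thesis using \<open>i \<le> j\<close> by (simp add: power_add[symmetric])
  qed
  have wd: "\<chi> h * z ^ i = \<chi> h' * z ^ j"
    if "h \<in> H" "h' \<in> H" "h \<otimes> a [^] i = h' \<otimes> a [^] j" for h h' and i j :: nat
    using wd_le[of h h' i j] wd_le[of h' h j i] that by (metis nat_le_linear)
  define K where "K = {h \<otimes> a [^] i |h i. h \<in> H \<and> i \<in> (UNIV :: nat set)}"
  define \<psi> where "\<psi> x = (SOME c. \<exists>h\<in>H. \<exists>i::nat. x = h \<otimes> a [^] i \<and> c = \<chi> h * z ^ i)" for x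
  have \<psi>: "\<psi> (h \<otimes> a [^] i) = \<chi> h * z ^ i" if "h \<in> H" for h and i :: nat
    unfolding \<psi>_def
  proof (rule some_equality)
    show "\<exists>h'\<in>H. \<exists>i'::nat. h \<otimes> a [^] i = h' \<otimes> a [^] i' \<and> \<chi> h * z ^ i = \<chi> h' * z ^ i'"
      using that by blast
  next
    fix c assume "\<exists>h'\<in>H. \<exists>i'::nat. h \<otimes> a [^] i = h' \<otimes> a [^] i' \<and> c = \<chi> h' * z ^ i'"
    then obtain h' and i' :: nat where h': "h' \<in> H" "h \<otimes> a [^] i = h' \<otimes> a [^] i'" "c = \<chi> h' * z ^ i'"
      by blast
    show "c = \<chi> h * z ^ i" unfolding h'(3) using wd[OF that h'(1,2)] by simp
  qed
  have KI: "h \<otimes> a [^] i \<in> K" if "h \<in> H" for h and i :: nat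
    using that by (auto simp: K_def)
  have prod: "(h \<otimes> a [^] i) \<otimes> (h' \<otimes> a [^] j) = (h \<otimes> h') \<otimes> a [^] (i + j)"
    if "h \<in> H" "h' \<in> H" for h h' and i j :: nat
  proof -
    have "h \<in> carrier G" "h' \<in> carrier G" using that Hc by auto
    then show ?thesis using a by (simp add: m_ac nat_pow_mult[symmetric])
  qed
  have K: "subgroup K G"
  proof (rule subgroupI)
    show "K \<subseteq> carrier G" using Hc a by (auto simp: K_def)
    show "K \<noteq> {}" using subgroup.one_closed[OF H] by (auto simp: K_def)
    fix x assume "x \<in> K"
    then obtain h and i :: nat where x: "x = h \<otimes> a [^] i" "h \<in> H" by (auto simp: K_def)
    have "h \<in> carrier G" using x Hc by auto
    \<comment> \<open>Exponents are natural numbers, so \<open>a [^] i\<close> is inverted by the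
      exponent \<open>i * (order G - 1)\<close>; the two add up to a multiple of the group
      order.\<close>
    have "x \<otimes> (inv h \<otimes> a [^] (i * (order G - 1))) = (h \<otimes> inv h) \<otimes> a [^] (i + i * (order G - 1))"
      using prod x H by (simp add: subgroup.m_inv_closed)
    also have "i + i * (order G - 1) = order G * i"
      using order_gt_0_iff_finite finite_carrier by (cases "order G") auto
    also have "a [^] (order G * i) = \<one>"
      using a pow_order_eq_1 by (simp add: nat_pow_pow[symmetric])
    finally have "x \<otimes> (inv h \<otimes> a [^] (i * (order G - 1))) = \<one>"
      using \<open>h \<in> carrier G\<close> by simp
    then have "inv x = inv h \<otimes> a [^] (i * (order G - 1))"
      using x a \<open>h \<in> carrier G\<close> by (metis inv_closed inv_equality m_closed m_comm nat_pow_closed)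
    then show "inv x \<in> K" using x H by (auto simp: K_def subgroup.m_inv_closed)
    fix y assume "y \<in> K"
    then obtain h' and j :: nat where y: "y = h' \<otimes> a [^] j" "h' \<in> H" by (auto simp: K_def)
    show "x \<otimes> y \<in> K"
      using prod x y H by (auto simp: K_def intro!: exI[of _ "h \<otimes> h'"] exI[of _ "i + j"] subgroup.m_closed)
  qed
  have "char_on K \<psi>"
    unfolding char_on_def
  proof safe
    fix x assume "x \<in> K" "\<psi> x = 0"
    then show False using \<psi> \<chi> z0 by (auto simp: K_def char_on_def)
  next
    fix x y assume "x \<in> K" "y \<in> K"
    then obtain h h' and i j :: nat
      where "x = h \<otimes> a [^] i" "h \<in> H" "y = h' \<otimes> a [^] j" "h' \<in> H" by (auto simp: K_def)
    then show "\<psi> (x \<otimes> y) = \<psi> x * \<psi> y"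
      using \<psi> prod mul H by (simp add: subgroup.m_closed power_add)
  qed
  moreover have ext: "\<psi> h = \<chi> h \<and> h \<in> K" if "h \<in> H" for h
  proof -
    have "h \<otimes> a [^] (0::nat) = h" using that Hc by auto
    then show ?thesis using \<psi>[OF that, of 0] KI[OF that, of 0] by simp
  qed
  moreover have "\<psi> a = z \<and> a \<in> K"
  proof -
    have "\<one> \<otimes> a [^] (1::nat) = a" using a by simp
    moreover have "\<one> \<in> H" "\<chi> \<one> = 1" using H \<chi> by (auto simp: subgroup.one_closed char_on_one)
    ultimately show ?thesis using \<psi>[of \<one> 1] KI[of \<one> 1] by simp
  qed
  ultimately show ?thesis using K by blast
qed

lemma least_pow_in_subgroup:
  assumes "subgroup H G" "a \<in> carrier G"
  shows "\<exists>r>0. a [^] (r::nat) \<in> H \<and> (\<forall>i. 0 < i \<longrightarrow> i < r \<longrightarrow> a [^] i \<notin> H)"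
proof -
  have "order G > 0 \<and> a [^] order G \<in> H"
    using assms pow_order_eq_1 order_gt_0_iff_finite by (simp add: subgroup.one_closed)
  then have "\<exists>r. r > 0 \<and> a [^] (r::nat) \<in> H" by blast
  then show ?thesis using exists_least_iff[of "\<lambda>r. r > 0 \<and> a [^] (r::nat) \<in> H"] by blast
qed

text \<open>Nonzero complex numbers have \<open>r\<close>-th roots, so
  \<open>char_extend_step\<close> applies to any element outside \<open>H\<close>; the complement
  shrinks until it is empty.\<close>

lemma char_extend:
  assumes "subgroup H G" "char_on H \<chi>"
  shows "\<exists>\<psi>. char_on (carrier G) \<psi> \<and> (\<forall>h\<in>H. \<psi> h = \<chi> h)"
  using assms
proof (induction "card (carrier G - H)" arbitrary: H \<chi> rule: less_induct)
  case less
  have Hc: "H \<subseteq> carrier G" using less.prems by (simp add: subgroup.subset)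
  show ?case
  proof (cases "H = carrier G")
    case True
    then show ?thesis using less.prems by blast
  next
    case False
    then obtain a where a: "a \<in> carrier G" "a \<notin> H" using Hc by blast
    from least_pow_in_subgroup[OF less.prems(1) a(1)] obtain r :: nat
      where "0 < r \<and> a [^] r \<in> H \<and> (\<forall>i. 0 < i \<longrightarrow> i < r \<longrightarrow> a [^] i \<notin> H)" ..
    then have r: "r > 0" "a [^] r \<in> H" "\<And>i. 0 < i \<Longrightarrow> i < r \<Longrightarrow> a [^] i \<notin> H"
      by simp_all
    let ?c = "\<chi> (a [^] r)"
    define z where "z = rcis (root r (cmod ?c)) (Arg ?c / r)"
    have z: "z ^ r = ?c"
      using r(1) by (simp add: z_def DeMoivre2 rcis_cmod_Arg)
    obtain K \<psi> where K: "subgroup K G" "char_on K \<psi>" "H \<subseteq> K" "a \<in> K" "\<forall>h\<in>H. \<psi> h = \<chi> h"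
      using char_extend_step[OF less.prems a(1) r z] by blast
    have "card (carrier G - K) < card (carrier G - H)"
      using K a by (intro psubset_card_mono) auto
    then obtain \<psi>' where "char_on (carrier G) \<psi>'" "\<forall>h\<in>K. \<psi>' h = \<psi> h"
      using less.hyps K by blast
    then show ?thesis using K by (metis subsetD)
  qed
qed

section \<open>Characters trivial on a subgroup, orthogonality and Hall subgroups\<close>

text \<open>Values outside the carrier are fixed to \<^const>\<open>undefined\<close>, so that the set is finite.\<close>

definition chars :: "'a set \<Rightarrow> ('a \<Rightarrow> complex) set"
  where "chars W = {\<chi> \<in> extensional (carrier G). char_on (carrier G) \<chi> \<and> (\<forall>x\<in>W. \<chi> x = 1)}"

definition trivial_char :: "'a \<Rightarrow> complex"
  where "trivial_char = (\<lambda>x\<in>carrier G. 1)"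

lemma trivial_char_in_chars: "W \<subseteq> carrier G \<Longrightarrow> trivial_char \<in> chars W"
  by (auto simp: chars_def trivial_char_def char_on_def)

lemma chars_mult: "\<chi> \<in> chars W \<Longrightarrow> x \<in> carrier G \<Longrightarrow> y \<in> carrier G \<Longrightarrow> \<chi> (x \<otimes> y) = \<chi> x * \<chi> y"
  by (auto simp: chars_def char_on_def)

lemma chars_nonzero: "\<chi> \<in> chars W \<Longrightarrow> x \<in> carrier G \<Longrightarrow> \<chi> x \<noteq> 0"
  by (auto simp: chars_def char_on_def)

lemma chars_one: "\<chi> \<in> chars W \<Longrightarrow> \<chi> \<one> = 1"
  using char_on_one[OF subgroup_self] by (auto simp: chars_def)

lemma finite_chars [simp]: "finite (chars W)"
proof -
  have "chars W \<subseteq> (\<Pi>\<^sub>E x\<in>carrier G. {z. z ^ order G = 1})"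
  proof
    fix \<chi> assume \<chi>: "\<chi> \<in> chars W"
    have "\<chi> x ^ order G = 1" if "x \<in> carrier G" for x
      using char_on_nat_pow[OF subgroup_self, of \<chi> x "order G"] that \<chi> chars_one[OF \<chi>] pow_order_eq_1
      by (auto simp: chars_def)
    then show "\<chi> \<in> (\<Pi>\<^sub>E x\<in>carrier G. {z. z ^ order G = 1})"
      using \<chi> by (auto simp: chars_def PiE_def)
  qed
  moreover have "finite {z::complex. z ^ order G = 1}"
    using order_gt_0_iff_finite finite_carrier by (intro finite_roots_unity) (simp add: Suc_leI)
  ultimately show ?thesis by (meson finite_PiE finite_carrier finite_subset)
qed

text \<open>The trivial character of \<open>W\<close> extends so that \<open>g\<close> goes to a
  primitive \<open>r\<close>-th root of unity, \<open>r\<close> being the order of \<open>g\<close>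
  modulo \<open>W\<close>; \<open>r > 1\<close> because \<open>g\<close> is outside
  \<open>W\<close>.\<close>

lemma chars_separate:
  assumes W: "subgroup W G" and g: "g \<in> carrier G" "g \<notin> W"
  shows "\<exists>\<chi>\<in>chars W. \<chi> g \<noteq> 1"
proof -
  have tr: "char_on W (\<lambda>_. 1)" by (simp add: char_on_def)
  from least_pow_in_subgroup[OF W g(1)] obtain r :: nat
    where "0 < r \<and> g [^] r \<in> W \<and> (\<forall>i. 0 < i \<longrightarrow> i < r \<longrightarrow> g [^] i \<notin> W)" ..
  then have r: "r > 0" "g [^] r \<in> W" "\<And>i. 0 < i \<Longrightarrow> i < r \<Longrightarrow> g [^] i \<notin> W"
    by simp_all
  have "r \<noteq> 1" using r(2) g by (cases "r = 1") simp_all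
  define z where "z = cis (2 * pi / r)"
  have z: "z ^ r = 1" using r by (simp add: z_def DeMoivre)
  have z1: "z \<noteq> 1"
  proof
    assume "z = 1"
    have inj: "inj_on (\<lambda>k. cis (2 * pi * real k / real r)) {..<r}"
      using bij_betw_roots_unity[OF r(1)] by (simp add: bij_betw_def)
    have "cis (2 * pi * real 1 / real r) = cis (2 * pi * real 0 / real r)"
      using \<open>z = 1\<close> by (simp add: z_def)
    then have "(1::nat) = 0"
      using inj_onD[OF inj, of 1 0] r(1) \<open>r \<noteq> 1\<close> by simp
    then show False by simp
  qed
  obtain K \<psi> where K: "subgroup K G" "char_on K \<psi>" "W \<subseteq> K" "g \<in> K" "\<forall>h\<in>W. \<psi> h = 1" "\<psi> g = z"
    using char_extend_step[OF W tr g(1) r, of z] z by auto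
  obtain \<chi> where \<chi>: "char_on (carrier G) \<chi>" "\<forall>h\<in>K. \<chi> h = \<psi> h"
    using char_extend K by blast
  have "restrict \<chi> (carrier G) \<in> chars W"
    using \<chi> K subgroup.subset[OF W] by (auto simp: chars_def char_on_def)
  then show ?thesis using \<chi> K g z1 by (intro bexI[of _ "restrict \<chi> (carrier G)"]) auto
qed

text \<open>Multiplication by a \<open>\<psi> \<in> chars W\<close> with
  \<open>\<psi> g \<noteq> 1\<close> permutes \<open>chars W\<close>, so for \<open>g\<close>
  outside \<open>W\<close> the sum equals \<open>\<psi> g\<close> times itself.\<close>

lemma sum_chars:
  assumes W: "subgroup W G" and g: "g \<in> carrier G"
  shows "(\<Sum>\<chi>\<in>chars W. \<chi> g) = (if g \<in> W then of_nat (card (chars W)) else 0)"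
proof (cases "g \<in> W")
  case True
  then have "(\<Sum>\<chi>\<in>chars W. \<chi> g) = (\<Sum>\<chi>\<in>chars W. 1)"
    by (intro sum.cong) (auto simp: chars_def)
  then show ?thesis using True by simp
next
  case False
  then obtain \<psi> where \<psi>: "\<psi> \<in> chars W" "\<psi> g \<noteq> 1" using chars_separate[OF W g] by blast
  let ?m = "\<lambda>\<chi>. \<lambda>x\<in>carrier G. \<psi> x * \<chi> x" and ?d = "\<lambda>\<chi>. \<lambda>x\<in>carrier G. \<chi> x / \<psi> x"
  have nz: "\<psi> x \<noteq> 0" if "x \<in> carrier G" for x using \<psi> that chars_nonzero by blast
  have Wc: "W \<subseteq> carrier G" using W by (rule subgroup.subset)
  have "(\<Sum>\<chi>\<in>chars W. \<chi> g) = (\<Sum>\<chi>\<in>chars W. \<psi> g * \<chi> g)"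
  proof (rule sum.reindex_bij_witness[of _ ?m ?d])
    fix \<chi> assume "\<chi> \<in> chars W"
    then have ex: "\<chi> \<in> extensional (carrier G)" by (simp add: chars_def)
    show "?m (?d \<chi>) = \<chi>" by (rule extensionalityI[OF _ ex]) (auto simp: nz)
    show "?d (?m \<chi>) = \<chi>" by (rule extensionalityI[OF _ ex]) (auto simp: nz)
    show "?m \<chi> \<in> chars W" "?d \<chi> \<in> chars W"
      using \<open>\<chi> \<in> chars W\<close> \<psi> Wc by (auto simp: chars_def char_on_def)
    show "\<psi> g * ?d \<chi> g = \<chi> g" using g nz by simp
  qed
  also have "\<dots> = \<psi> g * (\<Sum>\<chi>\<in>chars W. \<chi> g)" by (simp add: sum_distrib_left)
  finally show ?thesis using \<psi> False by simp
qed

text \<open>Translating the carrier by an \<open>h\<close> with \<open>\<chi> h \<noteq> 1\<close>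
  multiplies the sum by \<open>\<chi> h\<close>.\<close>

lemma sum_carrier_char:
  assumes "\<chi> \<in> chars W" "\<chi> \<noteq> trivial_char"
  shows "(\<Sum>g\<in>carrier G. \<chi> g) = 0"
proof -
  obtain h where h: "h \<in> carrier G" "\<chi> h \<noteq> 1"
  proof -
    have "\<exists>h\<in>carrier G. \<chi> h \<noteq> 1"
    proof (rule ccontr)
      assume "\<not> ?thesis"
      then have "\<chi> = trivial_char"
        using assms(1) by (intro extensionalityI[of _ "carrier G"]) (auto simp: chars_def trivial_char_def)
      then show False using assms by simp
    qed
    then show thesis using that by blast
  qed
  have "(\<Sum>g\<in>carrier G. \<chi> g) = (\<Sum>g\<in>carrier G. \<chi> (h \<otimes> g))"
    using h by (intro sum.reindex_bij_witness[of _ "\<lambda>g. h \<otimes> g" "\<lambda>g. inv h \<otimes> g"])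
      (auto simp: m_assoc[symmetric])
  also have "\<dots> = \<chi> h * (\<Sum>g\<in>carrier G. \<chi> g)"
    using h assms by (simp add: sum_distrib_left chars_mult)
  finally show ?thesis using h by simp
qed

lemma sum_carrier_trivial_char: "(\<Sum>g\<in>carrier G. trivial_char g) = of_nat (order G)"
  by (simp add: trivial_char_def order_def)

text \<open>Sum \<open>\<chi> g\<close> over all \<open>\<chi>\<close> and \<open>g\<close> in both
  orders: among the elements only those of \<open>W\<close> contribute, among the characters only
  the trivial one.\<close>

lemma card_chars:
  assumes W: "subgroup W G"
  shows "card (chars W) * card W = order G"
proof -
  have Wc: "W \<subseteq> carrier G" using W by (rule subgroup.subset)
  have "(of_nat (card (chars W) * card W) :: complex) = (\<Sum>g\<in>W. of_nat (card (chars W)))"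
    by simp
  also have "\<dots> = (\<Sum>g\<in>carrier G. if g \<in> W then of_nat (card (chars W)) else 0)"
    using Wc by (simp add: sum.If_cases Int_absorb1)
  also have "\<dots> = (\<Sum>g\<in>carrier G. \<Sum>\<chi>\<in>chars W. \<chi> g)"
    using sum_chars[OF W] by (intro sum.cong) auto
  also have "\<dots> = (\<Sum>\<chi>\<in>chars W. \<Sum>g\<in>carrier G. \<chi> g)"
    by (rule sum.swap)
  also have "\<dots> = (\<Sum>\<chi>\<in>chars W. if \<chi> = trivial_char then of_nat (order G) else 0)"
    using sum_carrier_char sum_carrier_trivial_char by (intro sum.cong) auto
  also have "\<dots> = of_nat (order G)"
    using trivial_char_in_chars[OF Wc] by simp
  finally show ?thesis using of_nat_eq_iff by blast
qed

text \<open>Averaging over the characters trivial on \<open>W\<close> projects onto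
  \<open>W\<close>; this is how character values yield intersection sizes.\<close>

lemma sum_subset_chars:
  assumes W: "subgroup W G" and D: "D \<subseteq> carrier G"
  shows "(\<Sum>\<chi>\<in>chars W. \<Sum>a\<in>D. \<chi> a) = of_nat (card (chars W) * card (D \<inter> W))"
proof -
  have fin: "finite D" using D finite_subset finite_carrier by blast
  have "(\<Sum>\<chi>\<in>chars W. \<Sum>a\<in>D. \<chi> a) = (\<Sum>a\<in>D. \<Sum>\<chi>\<in>chars W. \<chi> a)"
    by (rule sum.swap)
  also have "\<dots> = (\<Sum>a\<in>D. if a \<in> W then of_nat (card (chars W)) else 0)"
    using D sum_chars[OF W] by (intro sum.cong) auto
  also have "\<dots> = of_nat (card (chars W) * card (D \<inter> W))"
    using fin by (simp add: sum.If_cases)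
  finally show ?thesis .
qed

text \<open>Hall subgroups of an abelian group are kernels of power maps. The kernels
  \<open>?A\<close> and \<open>?B\<close> of the powers \<open>M\<close> and \<open>N\<close> have
  orders dividing \<open>M\<close> and \<open>N\<close>, and by Bezout every element is a product of
  one from each, which forces equality.\<close>

lemma card_pow_kernel:
  assumes o: "order G = M * N" and cop: "coprime M N"
  shows "subgroup {g \<in> carrier G. g [^] M = \<one>} G \<and> card {g \<in> carrier G. g [^] M = \<one>} = M"
proof -
  have sub: "subgroup {g \<in> carrier G. g [^] (n::nat) = \<one>} G" for n
  proof (rule subgroupI)
    show "{g \<in> carrier G. g [^] n = \<one>} \<noteq> {}" using nat_pow_one by blast
    fix a assume "a \<in> {g \<in> carrier G. g [^] n = \<one>}"
    then show "inv a \<in> {g \<in> carrier G. g [^] n = \<one>}" using nat_pow_inv[of a n] by simp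
    fix b assume "b \<in> {g \<in> carrier G. g [^] n = \<one>}"
    with \<open>a \<in> _\<close> show "a \<otimes> b \<in> {g \<in> carrier G. g [^] n = \<one>}"
      using nat_pow_distrib[of a b n] by simp
  qed simp
  \<comment> \<open>Stated for arbitrary \<open>M\<close> and \<open>N\<close> in order to serve
    both kernels. A common prime \<open>p\<close> would give a nonidentity element of order dividing
    \<open>p\<close> (Sylow with exponent 1); its order also divides \<open>M\<close>, which is
    prime to \<open>p\<close>.\<close>
  have cop_card: "coprime (card {g \<in> carrier G. g [^] M = \<one>}) N" if cop: "coprime M N" for M N :: nat
  proof (rule ccontr)
    let ?A = "{g \<in> carrier G. g [^] M = \<one>}"
    assume "\<not> coprime (card ?A) N"
    then have "gcd (card ?A) N \<noteq> 1" by (simp add: coprime_iff_gcd_eq_1)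
    from prime_factor_nat[OF this] obtain p
      where p: "Factorial_Ring.prime p" "p dvd card ?A" "p dvd N" by auto
    interpret A: group "G\<lparr>carrier := ?A\<rparr>" by (rule subgroup.subgroup_is_group[OF sub is_group])
    obtain q where q: "card ?A = p ^ 1 * q" using p by auto
    obtain P where P: "subgroup P (G\<lparr>carrier := ?A\<rparr>)" "card P = p ^ 1"
      using sylow_thm[OF p(1) A.is_group, of 1 q] q by (auto simp: order_def)
    have PA: "P \<subseteq> ?A" by (rule subset_trans[OF subgroup.subset[OF P(1)]]) simp
    have PG: "subgroup P G" by (rule incl_subgroup[OF sub P(1)])
    have "\<not> P \<subseteq> {\<one>}"
      using P(2) prime_gt_1_nat[OF p(1)] card_mono[of "{\<one>}" P] by auto
    then obtain x where x: "x \<in> P" "x \<noteq> \<one>" by blast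
    then have xc: "x \<in> carrier G" "x [^] M = \<one>" using PA by auto
    interpret Pg: group "G\<lparr>carrier := P\<rparr>" by (rule subgroup.subgroup_is_group[OF PG is_group])
    have "x [^] p = \<one>"
      using Pg.pow_order_eq_1[of x] x P(2) by (simp add: order_def nat_pow_consistent[symmetric])
    then have "group.ord G x dvd p" "group.ord G x dvd M" using xc pow_eq_id by auto
    moreover have "coprime p M" using cop p(3) by (meson coprime_commute coprime_divisors dvd_refl)
    ultimately have "group.ord G x = 1" by (metis coprime_common_divisor_nat)
    then show False using xc x pow_ord_eq_1[of x] by (simp add: ord_eq_1)
  qed
  have dvdG: "card {g \<in> carrier G. g [^] (n::nat) = \<one>} dvd M * N" for n
    unfolding o[symmetric] lagrange[OF sub[of n], symmetric] by simp
  let ?A = "{g \<in> carrier G. g [^] M = \<one>}" and ?B = "{g \<in> carrier G. g [^] N = \<one>}"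
  have A: "card ?A dvd M" using dvdG[of M] cop_card[OF cop] by (simp add: coprime_dvd_mult_left_iff)
  have B: "card ?B dvd N"
    using dvdG[of N] cop_card[of N M] cop by (simp add: coprime_dvd_mult_right_iff coprime_commute)
  have "carrier G \<subseteq> (\<lambda>(x, y). x \<otimes> y) ` (?A \<times> ?B)"
  proof
    fix g assume g: "g \<in> carrier G"
    have "M > 0" using o order_gt_0_iff_finite by (cases M) auto
    obtain x y where xy: "M * x = N * y + 1"
      using bezout_nat[of M N] cop \<open>M > 0\<close> by (auto simp: coprime_iff_gcd_eq_1)
    have 1: "g [^] (M * N * n) = \<one>" for n
      using g pow_order_eq_1[OF g] o by (simp add: nat_pow_pow[symmetric])
    \<comment> \<open>Up to multiples of the group order the exponent of \<open>a\<close> is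
      \<open>- N * y\<close>, while that of \<open>b\<close> is \<open>M * x = N * y + 1\<close>;
      hence the product is \<open>g\<close>.\<close>
    define a where "a = g [^] (N * (y * (M * N - 1)))"
    define b where "b = g [^] (M * x)"
    have "a \<otimes> b = g [^] (N * (y * (M * N - 1)) + (N * y + 1))"
      unfolding a_def b_def xy by (rule nat_pow_mult[OF g])
    also have "N * (y * (M * N - 1)) + (N * y + 1) = M * N * (N * y) + 1"
    proof -
      obtain t where "M * N = Suc t"
        using o order_gt_0_iff_finite finite_carrier by (cases "M * N") auto
      then show ?thesis by (simp add: algebra_simps)
    qed
    also have "g [^] \<dots> = g" unfolding nat_pow_mult[OF g, symmetric] 1 using g by simp
    finally have "a \<otimes> b = g" .
    moreover have "a [^] M = g [^] (M * N * (y * (M * N - 1)))"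
      unfolding a_def nat_pow_pow[OF g] by (simp add: mult_ac)
    then have "a \<in> ?A" using g 1 by (simp add: a_def)
    moreover have "b [^] N = g [^] (M * N * x)"
      unfolding b_def nat_pow_pow[OF g] by (simp add: mult_ac)
    then have "b \<in> ?B" using g 1 by (simp add: b_def)
    ultimately show "g \<in> (\<lambda>(x, y). x \<otimes> y) ` (?A \<times> ?B)" by force
  qed
  then have "card (carrier G) \<le> card (?A \<times> ?B)"
    by (intro surj_card_le) auto
  then have le: "M * N \<le> card ?A * card ?B" using o by (simp add: order_def card_cartesian_product)
  have pos: "M > 0" "N > 0" using o order_gt_0_iff_finite by (cases M; cases N; auto)+
  then have "card ?A \<le> M" "card ?B \<le> N" using A B by (auto intro: dvd_imp_le)
  then have "card ?A * card ?B \<le> card ?A * N" by simp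
  with le have "M * N \<le> card ?A * N" by linarith
  then have "card ?A = M" using \<open>card ?A \<le> M\<close> pos by simp
  then show ?thesis using sub by blast
qed

end

section \<open>Strong external difference families and character values\<close>

lemma lookup_set_elt: "finite A \<Longrightarrow> Poly_Mapping.lookup (set_elt A) x = (if x \<in> A then 1 else 0)"
  by (simp add: set_elt_def lookup_sum lookup_single when_def)

section \<open>Representation counts as group ring coefficients\<close>

context finite_comm_group
begin

text \<open>The coefficient of \<open>x\<close> in \<open>A B^(-1)\<close>: pairs with
  \<open>a \<otimes> inv b = x\<close> are counted by \<open>a\<close> alone, since \<open>b\<close>
  must be \<open>inv x \<otimes> a\<close>.\<close>

definition rep :: "'a set \<Rightarrow> 'a set \<Rightarrow> 'a \<Rightarrow> nat"
  where "rep A B x = card {a \<in> A. inv x \<otimes> a \<in> B}"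

lemma finite_subset_carrier: "A \<subseteq> carrier G \<Longrightarrow> finite A"
  using finite_subset finite_carrier by blast

lemma mult_inv_eq_iff:
  "a \<in> carrier G \<Longrightarrow> b \<in> carrier G \<Longrightarrow> x \<in> carrier G \<Longrightarrow> a \<otimes> inv b = x \<longleftrightarrow> b = inv x \<otimes> a"
  by (metis inv_closed inv_solve_left inv_solve_right m_comm)

lemma lookup_gring_mult:
  assumes A: "A \<subseteq> carrier G" and B: "B \<subseteq> carrier G"
  shows "Poly_Mapping.lookup (gring_mult G (set_elt A) (set_inv_elt G B)) x
    = (if x \<in> carrier G then int (rep A B x) else 0)"
proof -
  have fin: "finite A" "finite B" using A B finite_subset_carrier by auto
  have "Poly_Mapping.lookup (gring_mult G (set_elt A) (set_inv_elt G B)) x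
      = (\<Sum>a\<in>A. \<Sum>b\<in>B. if x = a \<otimes> inv b then 1 else 0)"
    using fin by (simp add: gring_mult_def set_elt_def set_inv_elt_def frag_extend_sum lookup_sum
      lookup_single when_def del: sum.delta sum.delta')
  also have "\<dots> = (\<Sum>a\<in>A. if x \<in> carrier G \<and> inv x \<otimes> a \<in> B then 1 else 0)"
  proof (rule sum.cong)
    fix a assume "a \<in> A"
    then have a: "a \<in> carrier G" using A by auto
    show "(\<Sum>b\<in>B. if x = a \<otimes> inv b then 1 else (0::int)) = (if x \<in> carrier G \<and> inv x \<otimes> a \<in> B then 1 else 0)"
    proof (cases "x \<in> carrier G")
      case True
      have "(\<Sum>b\<in>B. if x = a \<otimes> inv b then 1 else (0::int)) = (\<Sum>b\<in>B. if b = inv x \<otimes> a then 1 else 0)"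
        using a True B mult_inv_eq_iff[OF a _ True] by (intro sum.cong) (auto simp: eq_commute[of x] subset_iff)
      then show ?thesis using fin True by simp
    next
      case False
      have "x \<noteq> a \<otimes> inv b" if "b \<in> B" for b using that a B False by auto
      then show ?thesis using False by simp
    qed
  qed simp
  also have "\<dots> = (if x \<in> carrier G then int (rep A B x) else 0)"
    using fin by (simp add: rep_def sum.If_cases Int_def)
  finally show ?thesis .
qed

lemma gring_mult_sum_right:
  assumes "finite A" "finite I"
  shows "gring_mult G (set_elt A) (\<Sum>i\<in>I. q i) = (\<Sum>i\<in>I. gring_mult G (set_elt A) (q i))"
  using assms unfolding gring_mult_def set_elt_def
  by (simp add: frag_extend_sum comp_def) (rule sum.swap)

lemma lookup_set_inv_elt:
  assumes D: "D \<subseteq> carrier G"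
  shows "Poly_Mapping.lookup (set_inv_elt G D) x = (if x \<in> carrier G \<and> inv x \<in> D then 1 else 0)"
proof -
  have "Poly_Mapping.lookup (set_inv_elt G D) x = (\<Sum>a\<in>D. if x = inv a then 1 else 0)"
    by (simp add: set_inv_elt_def lookup_sum lookup_single when_def)
  also have "\<dots> = (\<Sum>a\<in>D. if a = inv x \<and> x \<in> carrier G then 1 else 0)"
    using D by (intro sum.cong) auto
  also have "\<dots> = (if x \<in> carrier G \<and> inv x \<in> D then 1 else 0)"
    using finite_subset_carrier[OF D] by (cases "x \<in> carrier G") auto
  finally show ?thesis .
qed

lemma set_elt_eq_set_inv_elt:
  assumes D: "D \<subseteq> carrier G"
  shows "set_elt D = set_inv_elt G D \<longleftrightarrow> (\<forall>x\<in>D. inv x \<in> D)"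
proof
  assume e: "set_elt D = set_inv_elt G D"
  show "\<forall>x\<in>D. inv x \<in> D"
  proof
    fix x assume "x \<in> D"
    then show "inv x \<in> D"
      using arg_cong[OF e, of "\<lambda>p. Poly_Mapping.lookup p x"] lookup_set_inv_elt[OF D, of x]
        lookup_set_elt[OF finite_subset_carrier[OF D], of x] by (simp split: if_splits)
  qed
next
  assume s: "\<forall>x\<in>D. inv x \<in> D"
  have "x \<in> carrier G \<and> inv x \<in> D \<longleftrightarrow> x \<in> D" for x
  proof
    assume "x \<in> carrier G \<and> inv x \<in> D"
    moreover from this have "inv (inv x) \<in> D" using s by blast
    ultimately show "x \<in> D" by simp
  qed (use s D in blast)
  then show "set_elt D = set_inv_elt G D"
    by (intro poly_mapping_eqI) (simp add: lookup_set_inv_elt[OF D] lookup_set_elt[OF finite_subset_carrier[OF D]])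
qed

lemma pds_iff:
  assumes D: "D \<subseteq> carrier G" "card D = k" "\<one> \<notin> D" and v: "order G = v"
  shows "pds G v k l' u D \<longleftrightarrow> (\<forall>x\<in>carrier G. int (rep D D x) =
    (if x = \<one> then int k - int u else 0) + (if x \<in> D then int l' else int u))"
proof -
  have fin: "finite D" using finite_subset_carrier D by blast
  have "Poly_Mapping.lookup (frag_cmul (int k - int u) (frag_of \<one>) + frag_cmul (int l') (set_elt D)
      + frag_cmul (int u) (set_elt (carrier G) - set_elt D)) x
    = (if x \<in> carrier G then (if x = \<one> then int k - int u else 0) + (if x \<in> D then int l' else int u) else 0)" for x
    using D fin by (auto simp: lookup_add lookup_minus lookup_set_elt lookup_single when_def)
  then show ?thesis
    using D v comm_group_axioms
    by (auto simp: pds_def poly_mapping_eq_iff fun_eq_iff lookup_gring_mult)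
qed

text \<open>A representation of \<open>inv x\<close> read backwards represents \<open>x\<close>. For
  \<open>A = B\<close> the counts are thus invariant under inversion, which later makes each
  \<open>D j\<close> closed under inverses.\<close>

lemma rep_swap:
  assumes A: "A \<subseteq> carrier G" and B: "B \<subseteq> carrier G" and x: "x \<in> carrier G"
  shows "rep A B (inv x) = rep B A x"
proof -
  have canc: "inv x \<otimes> (x \<otimes> a) = a" "x \<otimes> (inv x \<otimes> a) = a" if "a \<in> carrier G" for a
    using that x by (simp_all add: m_assoc[symmetric])
  have "card {a \<in> A. x \<otimes> a \<in> B} = card {b \<in> B. inv x \<otimes> b \<in> A}"
  proof (rule bij_betw_same_card, rule bij_betw_byWitness[of _ "\<lambda>b. inv x \<otimes> b" "\<lambda>a. x \<otimes> a"])
    show "\<forall>a\<in>{a \<in> A. x \<otimes> a \<in> B}. inv x \<otimes> (x \<otimes> a) = a" using A canc(1) by blast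
    show "\<forall>b\<in>{b \<in> B. inv x \<otimes> b \<in> A}. x \<otimes> (inv x \<otimes> b) = b" using B canc(2) by blast
    show "(\<lambda>a. x \<otimes> a) ` {a \<in> A. x \<otimes> a \<in> B} \<subseteq> {b \<in> B. inv x \<otimes> b \<in> A}"
    proof
      fix y assume "y \<in> (\<lambda>a. x \<otimes> a) ` {a \<in> A. x \<otimes> a \<in> B}"
      then obtain a where a: "a \<in> A" "y \<in> B" "y = x \<otimes> a" by blast
      then have "inv x \<otimes> y = a" using A canc(1) by blast
      then show "y \<in> {b \<in> B. inv x \<otimes> b \<in> A}" using a by simp
    qed
    show "(\<lambda>b. inv x \<otimes> b) ` {b \<in> B. inv x \<otimes> b \<in> A} \<subseteq> {a \<in> A. x \<otimes> a \<in> B}"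
    proof
      fix y assume "y \<in> (\<lambda>b. inv x \<otimes> b) ` {b \<in> B. inv x \<otimes> b \<in> A}"
      then obtain b where b: "b \<in> B" "y \<in> A" "y = inv x \<otimes> b" by blast
      then have "x \<otimes> y = b" using B canc(2) by blast
      then show "y \<in> {a \<in> A. x \<otimes> a \<in> B}" using b by simp
    qed
  qed
  then show ?thesis using x by (simp add: rep_def)
qed

lemma rep_one: "D \<subseteq> carrier G \<Longrightarrow> rep D D \<one> = card D"
  unfolding rep_def by (rule arg_cong[of _ _ card]) auto

text \<open>Pairs the coefficients of \<open>A B^(-1)\<close> with \<open>f\<close>: the constant 1
  counts all pairs, a character gives a product of character sums.\<close>

lemma sum_rep_times:
  fixes f :: "'a \<Rightarrow> 'c :: comm_ring_1"
  assumes A: "A \<subseteq> carrier G" and B: "B \<subseteq> carrier G"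
  shows "(\<Sum>x\<in>carrier G. of_nat (rep A B x) * f x) = (\<Sum>a\<in>A. \<Sum>b\<in>B. f (a \<otimes> inv b))"
proof -
  have fin: "finite A" "finite B" using A B finite_subset_carrier by auto
  have "(\<Sum>x\<in>carrier G. of_nat (rep A B x) * f x)
      = (\<Sum>x\<in>carrier G. \<Sum>a\<in>A. if inv x \<otimes> a \<in> B then f x else 0)"
    using fin by (intro sum.cong) (auto simp: rep_def sum.If_cases Int_def)
  also have "\<dots> = (\<Sum>a\<in>A. \<Sum>x\<in>carrier G. if inv x \<otimes> a \<in> B then f x else 0)"
    by (rule sum.swap)
  also have "\<dots> = (\<Sum>a\<in>A. \<Sum>b\<in>B. f (a \<otimes> inv b))"
  proof (rule sum.cong)
    fix a assume "a \<in> A"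
    then have a: "a \<in> carrier G" using A by auto
    have "(\<Sum>x\<in>carrier G. if inv x \<otimes> a \<in> B then f x else 0) = (\<Sum>x\<in>{x\<in>carrier G. inv x \<otimes> a \<in> B}. f x)"
      by (simp add: sum.inter_filter)
    also have "\<dots> = (\<Sum>b\<in>B. f (a \<otimes> inv b))"
    proof (rule sum.reindex_bij_witness[of _ "\<lambda>b. a \<otimes> inv b" "\<lambda>x. inv x \<otimes> a"])
      fix x assume x: "x \<in> {x \<in> carrier G. inv x \<otimes> a \<in> B}"
      then show e: "a \<otimes> inv (inv x \<otimes> a) = x" using mult_inv_eq_iff[of a "inv x \<otimes> a" x] a by simp
      then show "f (a \<otimes> inv (inv x \<otimes> a)) = f x" by simp
      show "inv x \<otimes> a \<in> B" using x by simp
    next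
      fix b assume "b \<in> B"
      then have b: "b \<in> carrier G" using B by auto
      then show "inv (a \<otimes> inv b) \<otimes> a = b" using mult_inv_eq_iff[of a b "a \<otimes> inv b"] a by simp
      then show "a \<otimes> inv b \<in> {x \<in> carrier G. inv x \<otimes> a \<in> B}" using a b \<open>b \<in> B\<close> by simp
    qed
    finally show "(\<Sum>x\<in>carrier G. if inv x \<otimes> a \<in> B then f x else 0) = (\<Sum>b\<in>B. f (a \<otimes> inv b))" .
  qed simp
  finally show ?thesis .
qed

end

section \<open>Partitions of the nonidentity elements into sets of equal size\<close>

locale nonidentity_partition = finite_comm_group +
  fixes D :: "nat \<Rightarrow> 'a set" and m k :: nat
  assumes Union_D: "(\<Union>i\<in>{1..m}. D i) = carrier G - {\<one>}"
    and disjoint_D: "disjoint_family_on D {1..m}"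
    and card_D: "i \<in> {1..m} \<Longrightarrow> card (D i) = k"
    and m_ge: "m \<ge> 2" and k_gt: "k > 1"
begin

lemma D_subset: "i \<in> {1..m} \<Longrightarrow> D i \<subseteq> carrier G"
  using Union_D by blast

lemma one_notin_D: "i \<in> {1..m} \<Longrightarrow> \<one> \<notin> D i"
  using Union_D by blast

lemma finite_D: "i \<in> {1..m} \<Longrightarrow> finite (D i)"
  using D_subset finite_subset_carrier by blast

lemma sum_over_D:
  fixes f :: "'a \<Rightarrow> 'c :: comm_monoid_add"
  shows "(\<Sum>i\<in>{1..m}. \<Sum>x\<in>D i. f x) = (\<Sum>x\<in>carrier G - {\<one>}. f x)"
  unfolding Union_D[symmetric]
  by (rule sum.UNION_disjoint[symmetric])
     (use finite_D disjoint_D in \<open>auto simp: disjoint_family_on_def\<close>)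

lemma order_eq: "order G = k * m + 1"
proof -
  have "k * m = (\<Sum>i\<in>{1..m}. \<Sum>x\<in>D i. 1)" using card_D by simp
  also have "\<dots> = order G - 1" unfolding sum_over_D by (simp add: order_def)
  finally show ?thesis using order_gt_0_iff_finite by simp
qed

text \<open>The sets \<open>D i\<close> add up to \<open>G - 1\<close>, so the products add up to
  \<open>D j (G - 1) = k G - D j\<close>.\<close>

lemma sum_rep_D:
  assumes j: "j \<in> {1..m}" and x: "x \<in> carrier G"
  shows "(\<Sum>i\<in>{1..m}. int (rep (D j) (D i) x)) = int k - (if x \<in> D j then 1 else 0)"
proof -
  have "(\<Sum>i\<in>{1..m}. rep (D j) (D i) x) = card (\<Union>i\<in>{1..m}. {a \<in> D j. inv x \<otimes> a \<in> D i})"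
    unfolding rep_def
    by (rule card_UN_disjoint[symmetric])
       (use finite_D[OF j] disjoint_D in \<open>auto simp: disjoint_family_on_def\<close>)
  also have "(\<Union>i\<in>{1..m}. {a \<in> D j. inv x \<otimes> a \<in> D i}) = {a \<in> D j. inv x \<otimes> a \<in> (\<Union>i\<in>{1..m}. D i)}"
    by blast
  also have "\<dots> = D j - {x}"
    unfolding Union_D
  proof -
    have "inv x \<otimes> a \<in> carrier G - {\<one>} \<longleftrightarrow> a \<noteq> x" if "a \<in> D j" for a
    proof -
      have a: "a \<in> carrier G" using that D_subset j by auto
      have "\<one> = inv x \<otimes> a \<longleftrightarrow> a = x"
        using mult_inv_eq_iff[of a \<one> x] a x by simp
      then show ?thesis using a x by auto
    qed
    then show "{a \<in> D j. inv x \<otimes> a \<in> carrier G - {\<one>}} = D j - {x}" by auto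
  qed
  finally have "(\<Sum>i\<in>{1..m}. rep (D j) (D i) x) = card (D j - {x})" .
  then have "int (\<Sum>i\<in>{1..m}. rep (D j) (D i) x) = int (card (D j - {x}))" by simp
  then show ?thesis
    using card_D[OF j] finite_D[OF j] k_gt by (auto simp: card_Diff_singleton)
qed

text \<open>The sum over \<open>i \<noteq> j\<close> is the full sum of \<open>sum_rep_D\<close>
  without the term \<open>i = j\<close>. Prescribing external differences therefore prescribes
  internal ones: \<open>D j D j^(-1) = l + (k - l) G - D j\<close>.\<close>

lemma sedf_iff:
  assumes l: "l \<ge> 1"
  shows "sedf G (order G) m k l D \<longleftrightarrow> (\<forall>j\<in>{1..m}. \<forall>x\<in>carrier G. int (rep (D j) (D j) x) =
    (if x = \<one> then int l else 0) + (int k - int l) - (if x \<in> D j then 1 else 0))"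
proof -
  have "gring_mult G (set_elt (D j)) (\<Sum>i\<in>{1..m} - {j}. set_inv_elt G (D i)) =
      frag_cmul (int l) (set_elt (carrier G) - frag_of \<one>)
    \<longleftrightarrow> (\<forall>x\<in>carrier G. int (rep (D j) (D j) x) =
      (if x = \<one> then int l else 0) + (int k - int l) - (if x \<in> D j then 1 else 0))"
    (is "?L = ?R \<longleftrightarrow> _") if j: "j \<in> {1..m}" for j
  proof -
    have "Poly_Mapping.lookup ?L x = (if x \<in> carrier G then
        int k - (if x \<in> D j then 1 else 0) - int (rep (D j) (D j) x) else 0)" for x
    proof -
      have "Poly_Mapping.lookup ?L x
          = (\<Sum>i\<in>{1..m} - {j}. if x \<in> carrier G then int (rep (D j) (D i) x) else 0)"
        using finite_D[OF j] D_subset j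
        by (simp add: gring_mult_sum_right lookup_sum lookup_gring_mult)
      also have "\<dots> = (if x \<in> carrier G then (\<Sum>i\<in>{1..m}. int (rep (D j) (D i) x)) - int (rep (D j) (D j) x) else 0)"
        using j by (simp add: sum_diff1)
      finally show ?thesis using sum_rep_D[OF j] by simp
    qed
    moreover have "Poly_Mapping.lookup ?R x = (if x \<in> carrier G then (if x = \<one> then 0 else int l) else 0)" for x
      by (auto simp: lookup_minus lookup_set_elt lookup_single when_def)
    ultimately have "?L = ?R \<longleftrightarrow> (\<forall>x\<in>carrier G. int k - (if x \<in> D j then 1 else 0) - int (rep (D j) (D j) x)
        = (if x = \<one> then 0 else int l))"
      by (auto simp: poly_mapping_eq_iff fun_eq_iff)
    also have "\<dots> \<longleftrightarrow> (\<forall>x\<in>carrier G. int (rep (D j) (D j) x) =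
      (if x = \<one> then int l else 0) + (int k - int l) - (if x \<in> D j then 1 else 0))"
      by (rule ball_cong) (auto simp: algebra_simps)
    finally show ?thesis .
  qed
  moreover have "\<forall>i\<in>{1..m}. D i \<subseteq> carrier G \<and> card (D i) = k"
    using D_subset card_D by blast
  ultimately show ?thesis
    unfolding sedf_def using l k_gt m_ge disjoint_D comm_group_axioms by simp
qed

end

text \<open>Arithmetic core of \<open>eigenvalues\<close>: \<open>1 + 4 * l\<close> is the squared
  difference of the two possible character values, and \<open>2 * a - m\<close> is the excess of the
  sets with the larger value over those with the smaller one.\<close>

lemma sedf_parameter_equation:
  fixes m u a l :: int
  assumes u: "u \<ge> 1" and l: "l = (m - 1) * u" and m: "m > 2" and t: "2 * a - m > 0"
    and e: "(2 * a - m)\<^sup>2 * (1 + 4 * l) = (m - 2)\<^sup>2"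
  shows "m = 4 * u + 3 \<and> 2 * a - m = 1"
proof -
  define t where "t = 2 * a - m"
  have t1: "t \<ge> 1" using t by (simp add: t_def)
  have "t\<^sup>2 dvd (m - 2)\<^sup>2" using e unfolding t_def by (metis dvd_triv_left)
  then have "t dvd m - 2" by simp
  then obtain d where d: "m - 2 = t * d" by blast
  have "d > 0" using d t1 m by (smt (verit) mult_nonneg_nonpos)
  have "t\<^sup>2 * (1 + 4 * l) = t\<^sup>2 * d\<^sup>2"
    using e unfolding t_def[symmetric] d by (simp add: power_mult_distrib)
  then have d2: "d\<^sup>2 = 1 + 4 * l" using t1 by simp
  have l1: "l \<ge> 1"
  proof -
    have "1 * 1 \<le> (m - 1) * u" using m u by (intro mult_mono) auto
    then show ?thesis using l by simp
  qed
  have "m - 1 = 1 + t * d" using d by simp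
  then have d2': "d\<^sup>2 = 1 + 4 * ((1 + t * d) * u)" using d2 l by simp
  \<comment> \<open>By \<open>d2'\<close> the number \<open>d\<close> divides
    \<open>4 * u + 1\<close>; \<open>e\<close> is the cofactor.\<close>
  define e where "e = d - 4 * t * u"
  have de: "d * e = 4 * u + 1" using d2' by (simp add: e_def power2_eq_square algebra_simps)
  have e1: "e \<ge> 1" using de u \<open>d > 0\<close> by (smt (verit) mult_nonneg_nonpos)
  have "t * (d * e) = t * (4 * u + 1)" using de by simp
  then have key: "d * (t * e - 1) = t - e" by (simp add: e_def algebra_simps)
  have te: "t * e - 1 \<ge> 0" using mult_mono[of 1 t 1 e] t1 e1 by simp
  \<comment> \<open>As \<open>d \<ge> 1\<close>, the identity \<open>key\<close> gives
    \<open>t * e - 1 \<le> t - e\<close>, which leaves only \<open>e = 1\<close>.\<close>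
  then have "t * e - 1 \<le> d * (t * e - 1)" using \<open>d > 0\<close> by (simp add: mult_le_cancel_right1)
  then have "(t + 1) * (e - 1) \<le> 0" using key by (simp add: algebra_simps)
  then have "e = 1" using t1 e1 by (smt (verit) mult_pos_pos)
  then have "d * (t - 1) = 1 * (t - 1)" using key by simp
  moreover have "d \<noteq> 1" using d2 l1 by auto
  ultimately have "t = 1" by (metis eq_iff_diff_eq_0 mult_cancel_right)
  then show ?thesis using d de \<open>e = 1\<close> by (simp add: t_def)
qed

section \<open>Parameters and character values of near-complete families\<close>

locale near_complete = nonidentity_partition +
  fixes l :: nat
  assumes l_ge: "l \<ge> 1"
    and rep_D: "j \<in> {1..m} \<Longrightarrow> x \<in> carrier G \<Longrightarrow> int (rep (D j) (D j) x) =
      (if x = \<one> then int l else 0) + (int k - int l) - (if x \<in> D j then 1 else 0)"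
begin

definition u :: nat where "u = k - l"

text \<open>Away from the identity the count is \<open>k - l - 1\<close> on \<open>D j\<close> and
  \<open>k - l\<close> off it. The counts thus determine \<open>D j\<close>, and they are invariant
  under inversion.\<close>

lemma inv_in_D:
  assumes j: "j \<in> {1..m}" and x: "x \<in> D j"
  shows "inv x \<in> D j"
proof -
  have xc: "x \<in> carrier G" "x \<noteq> \<one>" using D_subset one_notin_D j x by auto
  then have "inv x \<noteq> \<one>" by simp
  then show ?thesis
    using rep_D[OF j xc(1)] rep_D[OF j inv_closed[OF xc(1)]] rep_swap[OF D_subset[OF j] D_subset[OF j] xc(1)] x xc
    by (auto split: if_splits)
qed

text \<open>Adding up all coefficients of \<open>D 1 D 1^(-1)\<close> gives
  \<open>k * k = l + v * (k - l) - k\<close> with \<open>v = k * m + 1\<close>, which reduces to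
  \<open>k = m * (k - l)\<close>. In particular the subtraction in \<open>u\<close> does not
  truncate.\<close>

lemma parameters: "k = m * u" "l = (m - 1) * u" "u \<ge> 1" "order G = m\<^sup>2 * u + 1"
proof -
  have j: "1 \<in> {1..m}" using m_ge by simp
  have "(\<Sum>x\<in>carrier G. int (rep (D 1) (D 1) x)) = int k * int k"
    using sum_rep_times[OF D_subset[OF j] D_subset[OF j], of "\<lambda>_. 1 :: int"] card_D[OF j] by simp
  moreover have "(\<Sum>x\<in>carrier G. int (rep (D 1) (D 1) x))
      = (\<Sum>x\<in>carrier G. (if x = \<one> then int l else 0) + (int k - int l) - (if x \<in> D 1 then 1 else 0))"
    using rep_D[OF j] by (intro sum.cong) auto
  moreover have "\<dots> = int l + int (order G) * (int k - int l) - int k"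
    using D_subset[OF j] card_D[OF j]
    by (simp add: sum.distrib sum_subtractf order_def sum.If_cases Int_absorb1)
  ultimately have "int k * int k = int l + int (order G) * (int k - int l) - int k" by simp
  then have "int k * int k = int k * (int m * (int k - int l))"
    by (simp add: order_eq algebra_simps)
  then have km: "int k = int m * (int k - int l)" using k_gt by simp
  then have "int k - int l > 0" using k_gt m_ge
    by (metis less_trans of_nat_0_less_iff zero_less_mult_pos zero_less_one zero_less_two of_nat_less_iff pos2 less_le_trans)
  then have lk: "int u = int k - int l" "u \<ge> 1" unfolding u_def by auto
  then have "int k = int (m * u)" using km by simp
  then show k: "k = m * u" by linarith
  then show "order G = m\<^sup>2 * u + 1" by (simp add: order_eq power2_eq_square)
  have "l = k - u" using lk by linarith
  then show "l = (m - 1) * u" using k by (simp add: diff_mult_distrib)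
  show "u \<ge> 1" by (rule lk)
qed

definition S :: "('a \<Rightarrow> complex) \<Rightarrow> nat \<Rightarrow> complex"
  where "S \<chi> j = (\<Sum>a\<in>D j. \<chi> a)"

text \<open>Applying \<open>\<chi>\<close> to \<open>D j D j^(-1) = l + (k - l) G - D j\<close>
  gives \<open>S^2 = l - S\<close>: closure under inverses makes the left side a square, and the sum
  over \<open>G\<close> vanishes. Then complete the square.\<close>

lemma S_square:
  assumes \<chi>: "\<chi> \<in> chars W" "\<chi> \<noteq> trivial_char" and j: "j \<in> {1..m}"
  shows "(2 * S \<chi> j + 1)\<^sup>2 = of_nat (1 + 4 * l)"
proof -
  have Dc: "D j \<subseteq> carrier G" using D_subset j by blast
  have inv: "(\<Sum>b\<in>D j. \<chi> (inv b)) = S \<chi> j"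
    unfolding S_def
  proof (rule sum.reindex_bij_witness[of _ "\<lambda>x. inv x" "\<lambda>x. inv x"])
    fix a assume a: "a \<in> D j"
    then have "a \<in> carrier G" using Dc by blast
    then show "inv (inv a) = a" "inv (inv a) = a" by simp_all
    show "inv a \<in> D j" "inv a \<in> D j" using inv_in_D[OF j a] by simp_all
    show "\<chi> (inv a) = \<chi> (inv a)" ..
  qed
  have "(\<Sum>x\<in>carrier G. of_nat (rep (D j) (D j) x) * \<chi> x) = (\<Sum>a\<in>D j. \<Sum>b\<in>D j. \<chi> (a \<otimes> inv b))"
    by (rule sum_rep_times[OF Dc Dc])
  also have "\<dots> = (\<Sum>a\<in>D j. \<Sum>b\<in>D j. \<chi> a * \<chi> (inv b))"
    using Dc by (intro sum.cong refl chars_mult[OF \<chi>(1)]) auto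
  also have "\<dots> = S \<chi> j * S \<chi> j"
    by (simp add: sum_product[symmetric] inv) (simp add: S_def)
  finally have 1: "(\<Sum>x\<in>carrier G. of_nat (rep (D j) (D j) x) * \<chi> x) = S \<chi> j * S \<chi> j" .
  have "(of_nat (rep (D j) (D j) x) :: complex)
      = (if x = \<one> then of_nat l else 0) + (of_nat k - of_nat l) - (if x \<in> D j then 1 else 0)"
    if "x \<in> carrier G" for x
    using arg_cong[OF rep_D[OF j that], of "of_int :: int \<Rightarrow> complex"] by simp
  then have "(\<Sum>x\<in>carrier G. of_nat (rep (D j) (D j) x) * \<chi> x)
    = (\<Sum>x\<in>carrier G. (if x = \<one> then of_nat l * \<chi> x else 0) + (of_nat k - of_nat l) * \<chi> x - (if x \<in> D j then \<chi> x else 0))"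
    by (intro sum.cong) (auto simp: ring_distribs)
  also have "\<dots> = of_nat l * \<chi> \<one> + (of_nat k - of_nat l) * (\<Sum>x\<in>carrier G. \<chi> x) - (\<Sum>x\<in>carrier G. if x \<in> D j then \<chi> x else 0)"
    by (simp add: sum.distrib sum_subtractf sum_distrib_left)
  also have "(\<Sum>x\<in>carrier G. if x \<in> D j then \<chi> x else 0) = S \<chi> j"
    using Dc by (simp add: sum.If_cases Int_absorb1 S_def)
  finally have SS: "S \<chi> j * S \<chi> j = of_nat l - S \<chi> j"
    using 1 sum_carrier_char[OF \<chi>] chars_one[OF \<chi>(1)] by simp
  have "(2 * S \<chi> j + 1)\<^sup>2 = 4 * (S \<chi> j * S \<chi> j) + 4 * S \<chi> j + 1"
    by (simp add: power2_eq_square algebra_simps)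
  then show ?thesis unfolding SS by simp
qed

lemma sum_S:
  assumes \<chi>: "\<chi> \<in> chars W" "\<chi> \<noteq> trivial_char"
  shows "(\<Sum>j\<in>{1..m}. S \<chi> j) = -1"
proof -
  have "(\<Sum>j\<in>{1..m}. S \<chi> j) = (\<Sum>x\<in>carrier G. \<chi> x) - \<chi> \<one>"
    unfolding S_def sum_over_D by (simp add: sum_diff1)
  then show ?thesis using sum_carrier_char[OF \<chi>] chars_one[OF \<chi>(1)] by simp
qed

text \<open>The numbers \<open>2 * S \<chi> j + 1\<close> are \<open>d\<close> or \<open>- d\<close>
  with \<open>d^2 = 1 + 4 * l\<close>, and they add up to \<open>m - 2\<close>. If \<open>a\<close>
  of them equal \<open>d\<close>, then \<open>m - 2 = (2 * a - m) * d\<close>.\<close>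

lemma eigenvalues:
  assumes \<chi>: "\<chi> \<in> chars W" "\<chi> \<noteq> trivial_char" and m: "m > 2"
  shows "m = 4 * u + 3" and "j \<in> {1..m} \<Longrightarrow> S \<chi> j = of_nat (2 * u) \<or> S \<chi> j = - of_nat (2 * u + 1)"
    and "card {j \<in> {1..m}. S \<chi> j = - of_nat (2 * u + 1)} = 2 * u + 1"
proof -
  define d where "d = sqrt (1 + 4 * real l)"
  have d0: "d > 0" by (simp add: d_def add_pos_nonneg)
  have d2: "d\<^sup>2 = 1 + 4 * real l" by (simp add: d_def)
  have cases: "2 * S \<chi> j + 1 = of_real d \<or> 2 * S \<chi> j + 1 = - of_real d" if "j \<in> {1..m}" for j
  proof -
    have "(2 * S \<chi> j + 1)\<^sup>2 = of_real (d\<^sup>2)" using S_square[OF \<chi> that] by (simp add: d2)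
    then show ?thesis by (simp add: power2_eq_iff)
  qed
  define P where "P = {j \<in> {1..m}. 2 * S \<chi> j + 1 = of_real d}"
  define a where "a = card P"
  have fP: "finite P" "P \<subseteq> {1..m}" by (auto simp: P_def)
  have cP: "card ({1..m} - P) = m - a" "a \<le> m"
    using fP card_mono[of "{1..m}" P] by (auto simp: a_def card_Diff_subset)
  have "(\<Sum>j\<in>{1..m}. 2 * S \<chi> j + 1) = (\<Sum>j\<in>{1..m}. if j \<in> P then of_real d else - of_real d)"
    using cases by (intro sum.cong) (auto simp: P_def)
  also have "\<dots> = of_nat a * of_real d - of_nat (m - a) * of_real d"
    using fP cP by (simp add: sum.If_cases Int_absorb1 Diff_eq[symmetric] a_def)
  also have "(\<Sum>j\<in>{1..m}. 2 * S \<chi> j + 1) = of_nat m - 2"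
    using sum_S[OF \<chi>] by (simp add: sum.distrib sum_distrib_left[symmetric])
  finally have "complex_of_real (real m - 2) = of_real ((2 * real a - real m) * d)"
    using cP by (simp add: of_nat_diff algebra_simps)
  then have t: "real m - 2 = (2 * real a - real m) * d" by (simp only: of_real_eq_iff)
  moreover have "real m - 2 > 0" using m by simp
  ultimately have tpos: "2 * real a - real m > 0" using d0 by (metis zero_less_mult_pos2)
  \<comment> \<open>Squaring replaces the possibly irrational \<open>d\<close> and leaves an
    equation between integers.\<close>
  have "(2 * real a - real m)\<^sup>2 * (1 + 4 * real l) = (real m - 2)\<^sup>2"
    using t d2 by (simp add: power_mult_distrib)
  then have "real_of_int ((2 * int a - int m)\<^sup>2 * (1 + 4 * int l)) = real_of_int ((int m - 2)\<^sup>2)" by simp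
  then have e: "(2 * int a - int m)\<^sup>2 * (1 + 4 * int l) = (int m - 2)\<^sup>2" by (simp only: of_int_eq_iff)
  have li: "int l = (int m - 1) * int u" using arg_cong[OF parameters(2), of int] m by (simp add: of_nat_diff)
  have "int m = 4 * int u + 3 \<and> 2 * int a - int m = 1"
  proof (rule sedf_parameter_equation[OF _ li _ _ e])
    show "2 * int a - int m > 0" using tpos by linarith
  qed (use parameters(3) m in auto)
  then show m': "m = 4 * u + 3" and "card {j \<in> {1..m}. S \<chi> j = - of_nat (2 * u + 1)} = 2 * u + 1"
    and "j \<in> {1..m} \<Longrightarrow> S \<chi> j = of_nat (2 * u) \<or> S \<chi> j = - of_nat (2 * u + 1)"
  proof -
    assume ma: "int m = 4 * int u + 3 \<and> 2 * int a - int m = 1"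
    then show m': "m = 4 * u + 3" by linarith
    have a: "a = 2 * u + 2" using ma by linarith
    have d: "d = real (4 * u + 1)" using t ma m' a by simp
    have S: "S \<chi> j = of_nat (2 * u) \<longleftrightarrow> 2 * S \<chi> j + 1 = of_real d"
      "S \<chi> j = - of_nat (2 * u + 1) \<longleftrightarrow> 2 * S \<chi> j + 1 = - of_real d" for j
    proof -
      have "2 * S \<chi> j + 1 - of_real d = 2 * (S \<chi> j - of_nat (2 * u))"
        "2 * S \<chi> j + 1 + of_real d = 2 * (S \<chi> j + of_nat (2 * u + 1))"
        unfolding d by (simp_all add: algebra_simps)
      then show "S \<chi> j = of_nat (2 * u) \<longleftrightarrow> 2 * S \<chi> j + 1 = of_real d"
        "S \<chi> j = - of_nat (2 * u + 1) \<longleftrightarrow> 2 * S \<chi> j + 1 = - of_real d"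
        by (metis eq_iff_diff_eq_0 mult_eq_0_iff zero_neq_numeral)
          (metis \<open>2 * S \<chi> j + 1 + of_real d = _\<close> eq_neg_iff_add_eq_0 mult_eq_0_iff zero_neq_numeral)
    qed
    show "j \<in> {1..m} \<Longrightarrow> S \<chi> j = of_nat (2 * u) \<or> S \<chi> j = - of_nat (2 * u + 1)"
      using S cases by blast
    \<comment> \<open>The sets with the negative value form the complement of \<open>P\<close>; this
      uses that \<open>d\<close> and \<open>- d\<close> differ.\<close>
    have split: "{j \<in> A. f j = - c} = A - {j \<in> A. f j = c}"
      if "\<And>j. j \<in> A \<Longrightarrow> f j = c \<or> f j = - c" "c \<noteq> 0" for A and f :: "nat \<Rightarrow> complex" and c
    proof
      show "{j \<in> A. f j = - c} \<subseteq> A - {j \<in> A. f j = c}" using that(2) by auto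
      show "A - {j \<in> A. f j = c} \<subseteq> {j \<in> A. f j = - c}" using that(1) by blast
    qed
    have "{j \<in> {1..m}. S \<chi> j = - of_nat (2 * u + 1)} = {1..m} - P"
      unfolding S(2) P_def by (rule split) (use cases d0 in auto)
    then show "card {j \<in> {1..m}. S \<chi> j = - of_nat (2 * u + 1)} = 2 * u + 1"
      using cP a m' by simp
  qed
qed

section \<open>Divisibility conditions from intersections with Hall subgroups\<close>

definition neg_count :: "'a set \<Rightarrow> nat \<Rightarrow> nat"
  where "neg_count W j = card {\<chi> \<in> chars W - {trivial_char}. S \<chi> j = - of_nat (2 * u + 1)}"

context
  assumes m_gt: "m > 2"
begin

text \<open>The relation does not involve the character, so a single nontrivial one suffices; it
  exists because \<open>chars {\<one>}\<close> has \<open>order G > 1\<close> elements.\<close>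

lemma m_eq: "m = 4 * u + 3"
proof -
  have W: "subgroup {\<one>} G" by (rule triv_subgroup)
  have "card (chars {\<one>}) = order G" using card_chars[OF W] by simp
  then have "card (chars {\<one>}) > 1" using order_eq k_gt m_ge by simp
  then have "\<not> chars {\<one>} \<subseteq> {trivial_char}" using card_mono[of "{trivial_char}" "chars {\<one>}"] by auto
  then show ?thesis using eigenvalues(1) m_gt by blast
qed

lemma order_factored: "order G = (u + 1) * (4 * u + 1)\<^sup>2"
  unfolding parameters(4) m_eq by (simp add: power2_eq_square algebra_simps)

text \<open>Double counting: each nontrivial character is negative on exactly
  \<open>2 * u + 1\<close> of the sets.\<close>

lemma sum_neg_count:
  assumes W: "W \<subseteq> carrier G"
  shows "(\<Sum>j\<in>{1..m}. neg_count W j) = (2 * u + 1) * (card (chars W) - 1)"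
proof -
  have "(\<Sum>j\<in>{1..m}. neg_count W j)
      = (\<Sum>j\<in>{1..m}. \<Sum>\<chi>\<in>chars W - {trivial_char}. if S \<chi> j = - of_nat (2 * u + 1) then 1 else 0)"
    unfolding neg_count_def by (intro sum.cong) (simp_all add: sum.If_cases Int_def)
  also have "\<dots> = (\<Sum>\<chi>\<in>chars W - {trivial_char}. \<Sum>j\<in>{1..m}. if S \<chi> j = - of_nat (2 * u + 1) then 1 else 0)"
    by (rule sum.swap)
  also have "\<dots> = (\<Sum>\<chi>\<in>chars W - {trivial_char}. 2 * u + 1)"
  proof (rule sum.cong)
    fix \<chi> assume "\<chi> \<in> chars W - {trivial_char}"
    then show "(\<Sum>j\<in>{1..m}. if S \<chi> j = - of_nat (2 * u + 1) then 1 else 0) = 2 * u + 1"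
      using eigenvalues(3)[of \<chi> W] m_gt by (simp add: sum.If_cases Int_def)
  qed simp
  finally show ?thesis using trivial_char_in_chars[OF W] by (simp add: card_Diff_singleton)
qed

lemma neg_count_le:
  assumes W: "W \<subseteq> carrier G"
  shows "neg_count W j < card (chars W)"
proof -
  have "neg_count W j \<le> card (chars W - {trivial_char})"
    unfolding neg_count_def by (rule card_mono) auto
  also have "\<dots> < card (chars W)" using trivial_char_in_chars[OF W] by (rule card_Diff1_less[OF finite_chars])
  finally show ?thesis .
qed

text \<open>Average the values on \<open>D j\<close> over \<open>chars W\<close>: the trivial
  character contributes \<open>k = (4 * u + 3) * u\<close>, every other one \<open>2 * u\<close>,
  lowered by \<open>4 * u + 1\<close> if it is negative. The product form allows reduction modulo
  \<open>card (chars W)\<close> and modulo divisors of \<open>4 * u + 1\<close>.\<close>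

lemma intersection_equation:
  assumes W: "subgroup W G" and j: "j \<in> {1..m}"
  shows "int (card (chars W)) * (int (card (D j \<inter> W)) - 2 * int u) = int (4 * u + 1) * (int u - int (neg_count W j))"
proof -
  let ?X = "chars W - {trivial_char}" and ?N = "card (chars W)" and ?n = "neg_count W j"
  have Wc: "W \<subseteq> carrier G" by (rule subgroup.subset[OF W])
  have c1: "trivial_char \<in> chars W" by (rule trivial_char_in_chars[OF Wc])
  have N: "?N \<ge> 1" using neg_count_le[OF Wc, of j] by simp
  have "(of_nat (?N * card (D j \<inter> W)) :: complex) = (\<Sum>\<chi>\<in>chars W. S \<chi> j)"
    unfolding S_def by (rule sum_subset_chars[OF W D_subset[OF j], symmetric])
  also have "\<dots> = S trivial_char j + (\<Sum>\<chi>\<in>?X. S \<chi> j)"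
    using c1 by (rule sum.remove[OF finite_chars])
  also have "S trivial_char j = of_nat k"
    using D_subset[OF j] card_D[OF j] by (simp add: S_def trivial_char_def subset_iff)
  also have "(\<Sum>\<chi>\<in>?X. S \<chi> j)
      = (\<Sum>\<chi>\<in>?X. of_nat (2 * u) - of_nat (4 * u + 1) * (if S \<chi> j = - of_nat (2 * u + 1) then 1 else 0))"
  proof (rule sum.cong)
    fix \<chi> assume "\<chi> \<in> ?X"
    then show "S \<chi> j = of_nat (2 * u) - of_nat (4 * u + 1) * (if S \<chi> j = - of_nat (2 * u + 1) then 1 else 0)"
      using eigenvalues(2)[of \<chi> W j] m_gt j by (auto simp: algebra_simps)
  qed simp
  also have "\<dots> = of_nat (?N - 1) * of_nat (2 * u) - of_nat (4 * u + 1) * of_nat ?n"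
    using c1 by (simp add: sum_subtractf sum_distrib_left[symmetric] sum.If_cases Int_def
      neg_count_def card_Diff_singleton del: of_nat_add of_nat_mult)
  finally have "(of_int (int (?N * card (D j \<inter> W))) :: complex)
      = of_int (int k + int (?N - 1) * int (2 * u) - int (4 * u + 1) * int ?n)"
    by simp
  then have e: "int ?N * int (card (D j \<inter> W))
      = int k + (int ?N - 1) * (2 * int u) - (4 * int u + 1) * int ?n"
    using N by (simp only: of_int_eq_iff) (simp add: of_nat_diff)
  have k: "int k = (4 * int u + 3) * int u"
    using arg_cong[OF parameters(1), of int] by (simp add: m_eq)
  have "N * (d - 2 * v) = (4 * v + 1) * (v - n)"
    if "N * d = k' + (N - 1) * (2 * v) - (4 * v + 1) * n" "k' = (4 * v + 3) * v" for N d k' v n :: int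
    using that by (simp add: algebra_simps)
  from this[OF e k] show ?thesis by simp
qed

text \<open>Here every nontrivial character of the quotient of order \<open>N\<close> would have to take the negative
  eigenvalue on every \<open>D\<^sub>j\<close>, whereas each of them does so for only \<open>2\<mu> + 1\<close> of the \<open>4\<mu> + 3\<close> sets.\<close>

lemma no_coprime_factor:
  assumes N: "order G = M * N" "coprime M N" "N dvd u + 1" "coprime N (4 * u + 1)"
  shows "N = 1"
proof -
  define W where "W = {g \<in> carrier G. g [^] M = \<one>}"
  have W: "subgroup W G" "card W = M"
    using card_pow_kernel[OF N(1,2)] unfolding W_def by auto
  have Wc: "W \<subseteq> carrier G" by (rule subgroup.subset[OF W(1)])
  have "M > 0" using N(1) order_gt_0_iff_finite by (cases M) auto
  have cN: "card (chars W) = N"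
    using card_chars[OF W(1)] W(2) N(1) \<open>M > 0\<close> by simp
  have n: "neg_count W j = N - 1" if j: "j \<in> {1..m}" for j
  proof -
    \<comment> \<open>Modulo \<open>N\<close> the intersection equation makes
      \<open>neg_count W j\<close> congruent to \<open>u\<close>, hence to \<open>-1\<close>; the
      only such number below \<open>N\<close> is \<open>N - 1\<close>.\<close>
    have "int N dvd int (4 * u + 1) * (int u - int (neg_count W j))"
      using intersection_equation[OF W(1) j] unfolding cN by (metis dvd_triv_left)
    moreover have "coprime (int N) (int (4 * u + 1))" using N(4) by (simp only: coprime_int_iff)
    ultimately have "int N dvd int u - int (neg_count W j)"
      by (simp only: coprime_dvd_mult_right_iff)
    moreover have "int N dvd int u + 1" using N(3) by (metis of_nat_1 of_nat_add int_dvd_int_iff)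
    ultimately have "int N dvd (int u + 1) - (int u - int (neg_count W j))" by (rule dvd_diff[rotated])
    then have "int N dvd int (neg_count W j + 1)" by (simp add: add.commute)
    then have "N dvd neg_count W j + 1" by (simp only: int_dvd_int_iff)
    then have "N \<le> neg_count W j + 1" by (rule dvd_imp_le) simp
    then show ?thesis using neg_count_le[OF Wc, of j] cN by simp
  qed
  have "m * (N - 1) = (2 * u + 1) * (N - 1)"
    using sum_neg_count[OF Wc] n cN by simp
  then have "m = 2 * u + 1 \<or> N - 1 = 0" by (simp only: mult_cancel2)
  then have "N - 1 = 0" using m_eq by simp
  moreover have "N > 0" using N(1) order_gt_0_iff_finite by (cases N) auto
  ultimately show ?thesis by simp
qed

text \<open>Let \<open>N\<close> be the part of \<open>u + 1\<close> prime to 3. A common divisor of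
  \<open>N\<close> and \<open>4 * u + 1\<close> divides
  \<open>4 * (u + 1) - (4 * u + 1) = 3\<close>, so \<open>N\<close> is coprime to its cofactor in
  the group order and \<open>no_coprime_factor\<close> applies.\<close>

lemma u_plus_one_power_3: "\<exists>b. u + 1 = 3 ^ b"
proof -
  obtain N where N: "u + 1 = 3 ^ multiplicity 3 (u + 1) * N" "\<not> 3 dvd N"
    by (rule multiplicity_decompose'[of "u + 1" 3]) auto
  define b where "b = multiplicity 3 (u + 1)"
  have N': "u + 1 = 3 ^ b * N" using N(1) unfolding b_def .
  have p3: "Factorial_Ring.prime (3::nat)" by simp
  have c3: "coprime N 3" using N(2) p3 by (metis coprime_commute prime_imp_coprime)
  have cd: "coprime N (4 * u + 1)"
  proof (rule coprimeI)
    fix c assume c: "c dvd N" "c dvd 4 * u + 1"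
    have "c dvd 4 * (u + 1)" using c(1) N(1) by (metis dvd_mult dvd_trans dvd_triv_right)
    then have "c dvd 4 * (u + 1) - (4 * u + 1)" using c(2) by (rule dvd_diff_nat)
    moreover have "4 * (u + 1) - (4 * u + 1) = 3" by simp
    ultimately have "c dvd 3" by simp
    then show "is_unit c" using c3 c(1) coprime_common_divisor by blast
  qed
  have "order G = (3 ^ b * (4 * u + 1)\<^sup>2) * N"
    unfolding order_factored N' by (simp only: mult_ac)
  moreover have "coprime (3 ^ b * (4 * u + 1)\<^sup>2) N"
    using c3 cd by (simp add: coprime_commute)
  moreover have "N dvd u + 1" using N(1) by (metis dvd_triv_right)
  ultimately have "N = 1" using no_coprime_factor cd by blast
  then show ?thesis using N(1) by auto
qed

text \<open>If \<open>\<mu> + 1 = 3\<^sup>b\<close> with \<open>b \<ge> 2\<close>, then \<open>4\<mu> + 1 = 3 w\<close> with \<open>3 \<nmid> w\<close>; the subgroup \<open>W\<close> of order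
  \<open>w\<^sup>2\<close> meets each \<open>D\<^sub>j\<close> in a number of elements congruent to \<open>h = (w - 1) / 2\<close> modulo \<open>w\<close>, hence in
  at least \<open>h\<close> elements, and \<open>W\<close> is too small for that.\<close>

lemma u_eq_2: "u = 2"
proof -
  obtain b where b: "u + 1 = 3 ^ b" using u_plus_one_power_3 by blast
  have "b \<noteq> 0" using b parameters(3) by (cases b) simp_all
  then obtain c where c: "b = Suc c" using not0_implies_Suc by blast
  show ?thesis
  proof (cases "c = 0")
    case True
    then show ?thesis using b c by simp
  next
    case False
    \<comment> \<open>From \<open>u + 1 = 3 * 3 ^ c\<close> one gets
      \<open>4 * u + 1 = 3 * w\<close>, and \<open>h\<close> is the residue of \<open>2 * u\<close>
      modulo \<open>w\<close>.\<close>
    define h w where "h = 2 * 3 ^ c - (1::nat)" and "w = 4 * 3 ^ c - (1::nat)"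
    have hw: "w = 2 * h + 1" "h \<ge> 1" "w + 1 = 4 * 3 ^ c" "2 * u = w + h" "4 * u + 1 = 3 * w"
    proof -
      obtain p where p: "(3::nat) ^ c = Suc p" by (cases "(3::nat) ^ c") auto
      then show "w = 2 * h + 1" "h \<ge> 1" "w + 1 = 4 * 3 ^ c" "2 * u = w + h" "4 * u + 1 = 3 * w"
        using b by (simp_all add: h_def w_def c)
    qed
    have m3: "m = 3 * w + 2" using m_eq hw(5) by simp
    have cop3: "coprime w 3"
    proof (rule ccontr)
      assume "\<not> coprime w 3"
      then have "3 dvd w" using prime_imp_coprime[of "3::nat" w] by (auto simp: coprime_commute)
      moreover have "3 dvd w + 1" unfolding hw(3) using False by simp
      ultimately have "(3::nat) dvd 1" by (simp only: dvd_add_right_iff)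
      then show False by simp
    qed
    have o: "order G = w\<^sup>2 * (9 * 3 ^ b)"
      unfolding order_factored b hw(5) by (simp add: power_mult_distrib)
    have N: "9 * 3 ^ b = (3::nat) ^ (b + 2)" by simp
    have cop: "coprime (w\<^sup>2) (9 * 3 ^ b)"
      unfolding N using cop3 by (simp only: coprime_power_left_iff coprime_power_right_iff simp_thms)
    define W where "W = {g \<in> carrier G. g [^] w\<^sup>2 = \<one>}"
    have W: "subgroup W G" "card W = w\<^sup>2"
      using card_pow_kernel[OF o cop] unfolding W_def by auto
    have Wc: "W \<subseteq> carrier G" by (rule subgroup.subset[OF W(1)])
    have "w > 0" using hw by simp
    have cN: "card (chars W) = 3 ^ (b + 2)"
      using card_chars[OF W(1)] W(2) o \<open>w > 0\<close> by simp
    have ge: "card (D j \<inter> W) \<ge> h" if j: "j \<in> {1..m}" for j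
    proof (rule ccontr)
      let ?d = "card (D j \<inter> W)"
      assume "\<not> ?thesis"
      then have lt: "?d < h" by simp
      \<comment> \<open>Modulo \<open>w\<close> the size \<open>?d\<close> is congruent to
        \<open>2 * u\<close>, hence to \<open>h\<close>; if it were smaller than \<open>h\<close>,
        then \<open>h - ?d\<close> would be a positive multiple of \<open>w\<close> below
        \<open>w\<close>.\<close>
      have "int w dvd int (3 ^ (b + 2)) * (int ?d - 2 * int u)"
        unfolding intersection_equation[OF W(1) j, unfolded cN] hw(5) by simp
      moreover have "coprime (int w) (int (3 ^ (b + 2)))"
        using cop3 by (simp only: coprime_int_iff coprime_power_right_iff) simp
      ultimately have "int w dvd int ?d - 2 * int u" by (simp only: coprime_dvd_mult_right_iff)
      then have "int w dvd 2 * int u - int ?d" by (simp add: dvd_diff_commute)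
      moreover have "2 * int u - int ?d = int w + int (h - ?d)" using hw(4) lt by linarith
      ultimately have "int w dvd int (h - ?d)" by (simp add: dvd_add_right_iff)
      then have "w dvd h - ?d" by (simp only: int_dvd_int_iff)
      then have "w \<le> h - ?d" using lt by (intro dvd_imp_le) auto
      then show False using hw(1) by simp
    qed
    \<comment> \<open>The intersections are disjoint inside \<open>W - {\<one>}\<close>, which has
      \<open>(w - 1) * (w + 1) = 2 * h * (w + 1)\<close> elements; with \<open>m = 3 * w + 2\<close>
      this is less than \<open>m * h\<close>.\<close>
    have "m * h \<le> (\<Sum>j\<in>{1..m}. card (D j \<inter> W))"
      using sum_mono[of "{1..m}" "\<lambda>_. h" "\<lambda>j. card (D j \<inter> W)"] ge by simp
    also have "\<dots> = (\<Sum>j\<in>{1..m}. \<Sum>x\<in>D j. if x \<in> W then 1 else 0)"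
      using finite_D by (intro sum.cong) (simp_all add: sum.If_cases Int_def)
    also have "\<dots> = card ((carrier G - {\<one>}) \<inter> W)"
      unfolding sum_over_D by (simp add: sum.If_cases Int_def)
    also have "(carrier G - {\<one>}) \<inter> W = W - {\<one>}" using Wc by blast
    also have "card (W - {\<one>}) = w\<^sup>2 - 1"
      using W subgroup.one_closed[OF W(1)] by (simp add: card_Diff_singleton)
    also have "w\<^sup>2 - 1 = 2 * h * (w + 1)" unfolding hw(1) by (simp add: power2_eq_square algebra_simps)
    finally have "(3 * w + 2) * h \<le> (2 * (w + 1)) * h" unfolding m3 by (simp add: mult_ac)
    then have "3 * w + 2 \<le> 2 * (w + 1)" using hw(2) by simp
    then show ?thesis using \<open>w > 0\<close> by simp
  qed
qed

end

lemma parameter_dichotomy: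
  "m = 2 \<and> k = 2 * l \<and> order G = 4 * l + 1 \<or> m = 11 \<and> k = 22 \<and> l = 20 \<and> order G = 243"
proof (cases "m = 2")
  case True
  then show ?thesis using parameters by simp
next
  case False
  then have "m > 2" using m_ge by simp
  then show ?thesis using m_eq u_eq_2 parameters by simp
qed

end

section \<open>Nontrivial regular partial difference sets and the equivalence\<close>

context finite_comm_group
begin

text \<open>If \<open>D\<close> with the identity is a subgroup, each \<open>x \<in> D\<close> has
  \<open>card D - 1\<close> representations. If the complement is a subgroup, \<open>D\<close> is a
  union of its cosets and each \<open>x\<close> outside \<open>D\<close> has \<open>card D\<close>
  of them. The hypothesis on \<open>rep\<close> excludes both at once.\<close>

lemma not_trivial_pds_set:
  assumes D: "D \<subseteq> carrier G" "\<one> \<notin> D" "D \<noteq> {}" "card D + 1 < order G"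
    and rep: "\<And>x. x \<in> carrier G \<Longrightarrow> x \<noteq> \<one> \<Longrightarrow> rep D D x + (if x \<in> D then 1 else 0) \<noteq> card D"
  shows "\<not> trivial_pds_set G D"
proof -
  have fin: "finite D" using finite_subset_carrier[OF D(1)] .
  have "\<not> subgroup (D \<union> {\<one>}) G"
  proof
    assume H: "subgroup (D \<union> {\<one>}) G"
    obtain x where x: "x \<in> D" using D(3) by blast
    have xc: "x \<in> carrier G" using x D by blast
    have insert_one: "y \<in> D \<longleftrightarrow> \<one> \<noteq> y" if "y \<in> D \<union> {\<one>}" for y
      using that D(2) by auto
    have "inv x \<otimes> a \<in> D \<longleftrightarrow> a \<noteq> x" if "a \<in> D" for a
    proof -
      have a: "a \<in> carrier G" using that D by blast
      have "inv x \<in> D \<union> {\<one>}" by (rule subgroup.m_inv_closed[OF H]) (use x in blast)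
      then have "inv x \<otimes> a \<in> D \<union> {\<one>}" by (rule subgroup.m_closed[OF H]) (use that in blast)
      then have "inv x \<otimes> a \<in> D \<longleftrightarrow> \<one> \<noteq> inv x \<otimes> a" by (rule insert_one)
      moreover have "\<one> = inv x \<otimes> a \<longleftrightarrow> a = x"
        using mult_inv_eq_iff[of a \<one> x] a xc by simp
      ultimately show ?thesis by blast
    qed
    then have "{a \<in> D. inv x \<otimes> a \<in> D} = D - {x}" by blast
    then have "rep D D x + 1 = card D"
      unfolding rep_def using card.remove[OF fin x] by simp
    moreover have "x \<noteq> \<one>" using x D by blast
    ultimately show False using rep[OF xc] x by simp
  qed
  moreover have "\<not> subgroup (carrier G - D) G"
  proof
    assume H: "subgroup (carrier G - D) G"
    have "card (carrier G - D) > 1"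
      using D(4) card_Diff_subset[OF fin D(1)] by (simp add: order_def)
    then have "\<not> carrier G - D \<subseteq> {\<one>}" using card_mono[of "{\<one>}" "carrier G - D"] by auto
    then obtain x where x: "x \<in> carrier G" "x \<notin> D" "x \<noteq> \<one>" by blast
    have "inv x \<otimes> a \<in> D" if "a \<in> D" for a
    proof (rule ccontr)
      assume n: "inv x \<otimes> a \<notin> D"
      have a: "a \<in> carrier G" using that D by blast
      then have "inv x \<otimes> a \<in> carrier G - D" using x n by simp
      then have "x \<otimes> (inv x \<otimes> a) \<in> carrier G - D"
        by (rule subgroup.m_closed[OF H, rotated]) (use x in blast)
      moreover have "x \<otimes> (inv x \<otimes> a) = a" using x a by (simp add: m_assoc[symmetric])
      ultimately show False using that by simp
    qed
    then have "{a \<in> D. inv x \<otimes> a \<in> D} = D" by blast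
    then have "rep D D x = card D" by (simp add: rep_def)
    then show False using rep[OF x(1,3)] x by simp
  qed
  ultimately show ?thesis by (simp add: trivial_pds_set_def)
qed

end

text \<open>Off the identity the count plus the indicator of \<open>D j\<close> is
  \<open>k - l\<close>. This gives both parameters, and as it lies below \<open>k\<close> it also
  excludes triviality.\<close>

lemma (in near_complete) nontrivial_regular_pds_D:
  assumes j: "j \<in> {1..m}" and u': "u' = k - l" "l' = u' - 1"
  shows "nontrivial_regular_pds G (order G) k l' u' (D j)"
proof -
  have lk: "l < k" using parameters(3) unfolding u_def by simp
  have "rep (D j) (D j) x + (if x \<in> D j then 1 else 0) \<noteq> card (D j)"
    if x: "x \<in> carrier G" "x \<noteq> \<one>" for x
    using rep_D[OF j x(1)] x(2) l_ge lk unfolding card_D[OF j] by (auto split: if_splits)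
  moreover have "card (D j) + 1 < order G"
  proof -
    have "k * 2 \<le> k * m" using m_ge by simp
    then show ?thesis unfolding order_eq card_D[OF j] using k_gt by linarith
  qed
  moreover have "D j \<noteq> {}" using card_D[OF j] k_gt by auto
  ultimately have "\<not> trivial_pds_set G (D j)"
    using not_trivial_pds_set[OF D_subset[OF j] one_notin_D[OF j]] by blast
  moreover have "pds G (order G) k l' u' (D j)"
    unfolding pds_iff[OF D_subset[OF j] card_D[OF j] one_notin_D[OF j] refl]
  proof
    fix x assume "x \<in> carrier G"
    then show "int (rep (D j) (D j) x)
        = (if x = \<one> then int k - int u' else 0) + (if x \<in> D j then int l' else int u')"
      using rep_D[OF j] lk one_notin_D[OF j] by (auto simp: u' of_nat_diff)
  qed
  moreover have "set_elt (D j) = set_inv_elt G (D j)"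
    unfolding set_elt_eq_set_inv_elt[OF D_subset[OF j]] using inv_in_D[OF j] by blast
  ultimately show ?thesis by (simp add: nontrivial_regular_pds_def regular_pds_def)
qed

context nonidentity_partition
begin

lemma pds_rep:
  assumes "nontrivial_regular_pds G v k l' u' (D j)" and "j \<in> {1..m}" "x \<in> carrier G"
  shows "int (rep (D j) (D j) x)
    = (if x = \<one> then int k - int u' else 0) + (if x \<in> D j then int l' else int u')"
  using assms pds_iff[OF D_subset card_D one_notin_D, of j v l' u']
  by (auto simp: nontrivial_regular_pds_def regular_pds_def pds_def)

text \<open>Case (1) constrains \<open>D 1\<close> only. Comparing \<open>sum_rep_D\<close> for
  \<open>D 2\<close> at \<open>x\<close> with that for \<open>D 1\<close> at \<open>inv x\<close>
  cancels the mixed counts and transfers the condition to \<open>D 2\<close>.\<close>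

lemma rep_eq_two:
  assumes m2: "m = 2" and sym: "\<And>x. x \<in> D 1 \<Longrightarrow> inv x \<in> D 1"
    and x: "x \<in> carrier G"
  shows "int (rep (D 2) (D 2) x)
    = int (rep (D 1) (D 1) x) + (if x \<in> D 1 then 1 else 0) - (if x \<in> D 2 then 1 else 0)"
proof -
  have j: "1 \<in> {1..m}" "2 \<in> {1..m}" and I: "{1..m} = {1, 2}" using m2 by auto
  have "inv x \<in> D 1 \<longleftrightarrow> x \<in> D 1" using sym[of x] sym[of "inv x"] x by auto
  moreover have "rep (D 2) (D 1) x = rep (D 1) (D 2) (inv x)"
    using rep_swap[OF D_subset[OF j(1)] D_subset[OF j(2)] x] by simp
  moreover have "rep (D 1) (D 1) (inv x) = rep (D 1) (D 1) x"
    by (rule rep_swap[OF D_subset[OF j(1)] D_subset[OF j(1)] x])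
  ultimately show ?thesis
    using sum_rep_D[OF j(2) x] sum_rep_D[OF j(1) inv_closed[OF x]] unfolding I
    by (simp split: if_splits)
qed

text \<open>Forwards this is \<open>parameter_dichotomy\<close>. Backwards, in both cases
  \<open>\<mu> = k - l\<close> and \<open>\<lambda>' = \<mu> - 1\<close>, so the counts of the
  partial difference sets are those required by \<open>sedf_iff\<close>.\<close>

lemma sedf_iff_pds:
  assumes l: "l > 0" and v: "order G = v"
  shows "nontrivial_sedf G v m k l D \<and> near_complete_sedf G v m k l D \<longleftrightarrow>
    ((v, m, k, l) = (v, 2, (v - 1) div 2, (v - 1) div 4) \<and> v mod 4 = 1 \<and>
      nontrivial_regular_pds G v ((v - 1) div 2) ((v - 5) div 4) ((v - 1) div 4) (D 1))
    \<or> ((v, m, k, l) = (243, 11, 22, 20) \<and>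
      (\<forall>j\<in>{1..11}. nontrivial_regular_pds G 243 22 1 2 (D j)))"
    (is "_ \<longleftrightarrow> ?one \<or> ?two")
proof -
  have l1: "l \<ge> 1" using l by simp
  have ord: "v = k * m + 1" using order_eq v by simp
  have "nontrivial_sedf G v m k l D \<and> near_complete_sedf G v m k l D \<longleftrightarrow> sedf G v m k l D"
    using k_gt ord by (auto simp: nontrivial_sedf_def near_complete_sedf_def)
  also have "\<dots> \<longleftrightarrow> (\<forall>j\<in>{1..m}. \<forall>x\<in>carrier G. int (rep (D j) (D j) x) =
    (if x = \<one> then int l else 0) + (int k - int l) - (if x \<in> D j then 1 else 0))" (is "_ \<longleftrightarrow> ?rep")
    using sedf_iff[OF l1] v by simp
  also have "\<dots> \<longleftrightarrow> ?one \<or> ?two"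
  proof
    assume ?rep
    then interpret near_complete G D m k l by unfold_locales (use l1 in auto)
    from parameter_dichotomy show "?one \<or> ?two"
    proof
      assume p: "m = 2 \<and> k = 2 * l \<and> order G = 4 * l + 1"
      then have vl: "v = 4 * l + 1" using v by simp
      have e: "(v - 1) div 2 = k" "(v - 5) div 4 = l - 1" "(v - 1) div 4 = l" "v mod 4 = 1"
        using p unfolding vl by auto
      have "nontrivial_regular_pds G (order G) k (l - 1) l (D 1)"
        by (rule nontrivial_regular_pds_D) (use p in auto)
      then show ?thesis using p v e by simp
    next
      assume p: "m = 11 \<and> k = 22 \<and> l = 20 \<and> order G = 243"
      have "nontrivial_regular_pds G (order G) k 1 2 (D j)" if "j \<in> {1..m}" for j
        by (rule nontrivial_regular_pds_D) (use p that in auto)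
      then show ?thesis using p v by simp
    qed
  next
    assume "?one \<or> ?two"
    then show ?rep
    proof
      assume one: ?one
      then have m2: "m = 2" and l_eq: "l = (v - 1) div 4" and v4: "v mod 4 = 1" by auto
      have k2: "k = 2 * l" using ord m2 l_eq v4 by presburger
      then have vl: "v = 4 * l + 1" using ord m2 by simp
      have "(v - 1) div 2 = k" "(v - 5) div 4 = l - 1" "(v - 1) div 4 = l"
        using k2 unfolding vl by auto
      then have nrp: "nontrivial_regular_pds G v k (l - 1) l (D 1)" using one by simp
      have j: "1 \<in> {1..m}" using m2 by simp
      have r1: "int (rep (D 1) (D 1) x) =
          (if x = \<one> then int l else 0) + (int k - int l) - (if x \<in> D 1 then 1 else 0)"
        if "x \<in> carrier G" for x
        using pds_rep[OF nrp j that] k2 l1 by (simp add: of_nat_diff)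
      have sym: "inv x \<in> D 1" if "x \<in> D 1" for x
        using nrp set_elt_eq_set_inv_elt[OF D_subset[OF j]] that
        by (simp add: nontrivial_regular_pds_def regular_pds_def)
      have r2: "int (rep (D 2) (D 2) x) =
          (if x = \<one> then int l else 0) + (int k - int l) - (if x \<in> D 2 then 1 else 0)"
        if "x \<in> carrier G" for x
        using rep_eq_two[OF m2 sym that] r1[OF that] by simp
      show ?rep
      proof (intro ballI)
        fix j x assume "j \<in> {1..m}" "x \<in> carrier G"
        moreover from this have "j = 1 \<or> j = 2" using m2 by auto
        ultimately show "int (rep (D j) (D j) x) =
          (if x = \<one> then int l else 0) + (int k - int l) - (if x \<in> D j then 1 else 0)"
          using r1 r2 by blast
      qed
    next
      assume two: ?two
      show ?rep
      proof (intro ballI)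
        fix j x assume j: "j \<in> {1..m}" and x: "x \<in> carrier G"
        have "nontrivial_regular_pds G 243 k 1 2 (D j)" using two j by simp
        from pds_rep[OF this j x] show "int (rep (D j) (D j) x) =
          (if x = \<one> then int l else 0) + (int k - int l) - (if x \<in> D j then 1 else 0)"
          using two by simp
      qed
    qed
  qed
  finally show ?thesis .
qed

end

section \<open>The family in the elementary abelian group of order 243\<close>

type_synonym state = "int \<times> int \<times> int \<times> int \<times> int"

text \<open>The linear recurrence \<open>s(n+5) = s(n+4) + 2 * s(n)\<close> modulo 3, i.e.
  multiplication by a root of \<open>X^5 - X^4 - 2\<close>. That this root is primitive follows from
  \<open>lfsr_eq_iff\<close>.\<close>

fun step :: "state \<Rightarrow> state"
  where "step (a, b, c, d, e) = (b, c, d, e, (2 * a + e) mod 3)"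

fun diff3 :: "state \<Rightarrow> state \<Rightarrow> state"
  where "diff3 (a, b, c, d, e) (a', b', c', d', e')
    = ((a - a') mod 3, (b - b') mod 3, (c - c') mod 3, (d - d') mod 3, (e - e') mod 3)"

definition start :: state where "start = (0, 0, 0, 0, 1)"

fun states_from :: "nat \<Rightarrow> state \<Rightarrow> state list"
  where "states_from 0 s = []" | "states_from (Suc n) s = s # states_from n (step s)"

text \<open>Position \<open>d - 1\<close> holds the \<open>z\<close> with \<open>x\<^sup>d - 1 = x\<^sup>z\<close>, where \<open>x\<close> generates the multiplicative group of
  \<open>GF(3\<^sup>5)\<close> and a field element is represented by a state of the shift register \<open>step\<close>.\<close>

definition zech_table :: "nat list"
  where "zech_table =
    [117, 49, 109, 5, 57, 147, 92, 62, 85, 61, 158, 15, 100, 229, 171, 213, 37, 199, 82, 104,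
     34, 54, 63, 186, 177, 127, 13, 195, 36, 183, 176, 99, 232, 169, 239, 45, 132, 3, 58, 98,
     187, 203, 10, 167, 29, 165, 119, 155, 198, 136, 111, 116, 238, 113, 152, 146, 4, 81, 67,
     70, 43, 151, 102, 69, 145, 162, 89, 190, 189, 224, 204, 74, 215, 149, 47, 112, 170, 139,
     219, 56, 39, 163, 192, 101, 114, 71, 108, 18, 59, 65, 220, 137, 44, 194, 84, 55, 66, 200,
     212, 27, 95, 23, 191, 236, 233, 118, 73, 135, 38, 6, 154, 226, 22, 9, 225, 120, 174, 156,
     75, 52, 0, 53, 77, 159, 178, 125, 231, 16, 30, 235, 164, 17, 50, 148, 87, 133, 7, 11, 209,
     42, 115, 48, 234, 223, 90, 80, 110, 221, 72, 166, 8, 96, 91, 51, 142, 106, 150, 138, 230,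
     202, 79, 97, 19, 182, 214, 157, 93, 196, 21, 123, 12, 33, 241, 1, 143, 217, 201, 126, 160,
     210, 103, 131, 129, 144, 68, 211, 218, 180, 64, 185, 181, 207, 28, 228, 193, 240, 105, 2,
     88, 40, 25, 179, 140, 86, 216, 130, 83, 14, 78, 188, 24, 32, 128, 46, 107, 222, 31, 41,
     161, 153, 134, 205, 184, 60, 141, 76, 35, 94, 208, 124, 26, 172, 197, 175, 206, 20, 173,
     122, 227, 168, 237]"

text \<open>The table is checked by evaluation against all differences. \<open>tl\<close> drops the
  exponent 0, whose difference is zero and has no logarithm.\<close>

lemma zech_table_correct:
  "map (\<lambda>v. diff3 v start) (tl (states_from 242 start)) = (let L = states_from 242 start in map (\<lambda>i. L ! i) zech_table)"
  by code_simp

lemma step_period: "last (states_from 243 start) = start"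
  by code_simp

text \<open>The solutions of \<open>x^d - 1 = x^z\<close> with both exponents in the same class
  modulo 11: residue 0 occurs once, every other residue twice.\<close>

lemma zech_hits:
  "filter (\<lambda>(d, z). d mod 11 = z mod 11) (zip [1..<242] zech_table) =
    [(43, 10), (67, 89), (70, 224), (95, 84), (103, 191), (104, 236), (115, 225), (119, 75),
     (121, 0), (129, 30), (131, 164), (145, 90), (146, 80), (149, 72), (151, 8), (193, 28),
     (196, 240), (201, 25), (205, 216), (210, 188), (211, 24)]"
  by code_simp

lemma zech_table_bounds: "list_all (\<lambda>z. z < 242) zech_table" "length zech_table = 241"
  by (simp_all add: zech_table_def)

section \<open>Powers of the generator as vectors over the integers modulo 3\<close>

definition lfsr :: "nat \<Rightarrow> state" where "lfsr n = (step ^^ n) start"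

definition zech :: "nat \<Rightarrow> nat" where "zech d = zech_table ! (d - 1)"

definition valid :: "state set"
  where "valid = {0..<3} \<times> {0..<3} \<times> {0..<3} \<times> {0..<3} \<times> {0..<3}"

fun vec :: "state \<Rightarrow> nat \<Rightarrow> int"
  where "vec (a, b, c, d, e)
    = (\<lambda>i\<in>{1..5}. if i = 1 then a else if i = 2 then b else if i = 3 then c else if i = 4 then d else e)"

lemma length_states_from: "length (states_from n s) = n"
  by (induction n arbitrary: s) auto

lemma nth_states_from: "i < n \<Longrightarrow> states_from n s ! i = (step ^^ i) s"
proof (induction n arbitrary: i s)
  case (Suc n)
  then show ?case by (cases i) (simp_all add: funpow_swap1)
qed simp

lemma lfsr_period: "lfsr (n + 242 * q) = lfsr n"
proof -
  have "states_from 243 start \<noteq> []" using length_states_from[of 243 start] by (metis list.size(3) zero_neq_numeral)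
  then have "last (states_from 243 start) = states_from 243 start ! 242"
    by (simp add: last_conv_nth length_states_from)
  also have "\<dots> = (step ^^ 242) start" by (rule nth_states_from) simp
  finally have p: "(step ^^ 242) start = start" using step_period by simp
  have "(step ^^ (242 * q)) start = start"
    by (induction q) (simp_all only: mult_0_right mult_Suc_right funpow_add comp_apply p funpow_0)
  then show ?thesis by (simp add: lfsr_def funpow_add)
qed

lemma lfsr_mod: "lfsr (n mod 242) = lfsr n"
  using lfsr_period[of "n mod 242" "n div 242"] by simp

text \<open>\<open>step\<close> is linear modulo 3; only the feedback coordinate needs an
  argument.\<close>

lemma diff3_step: "diff3 (step s) (step t) = step (diff3 s t)"
proof -
  have "((2 * a + e) mod 3 - (2 * a' + e') mod 3) mod 3 = (2 * ((a - a') mod 3) + (e - e') mod 3) mod 3"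
    for a e a' e' :: int
  proof -
    have "((2 * a + e) mod 3 - (2 * a' + e') mod 3) mod 3 = (2 * a + e - (2 * a' + e')) mod 3"
      by (rule mod_diff_eq)
    also have "\<dots> = (2 * (a - a') + (e - e')) mod 3" by (simp add: algebra_simps)
    also have "\<dots> = ((2 * (a - a')) mod 3 + (e - e') mod 3) mod 3" by (rule mod_add_eq[symmetric])
    also have "(2 * (a - a')) mod 3 = (2 * ((a - a') mod 3)) mod 3" by (rule mod_mult_right_eq[symmetric])
    also have "(\<dots> + (e - e') mod 3) mod 3 = (2 * ((a - a') mod 3) + (e - e') mod 3) mod 3"
      by (rule mod_add_left_eq)
    finally show ?thesis .
  qed
  then show ?thesis by (cases s; cases t) simp
qed

lemma diff3_lfsr_shift: "diff3 (lfsr (n + a)) (lfsr (n + b)) = (step ^^ n) (diff3 (lfsr a) (lfsr b))"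
  by (induction n) (simp_all add: lfsr_def diff3_step)

lemma zech_less: "1 \<le> d \<Longrightarrow> d < 242 \<Longrightarrow> zech d < 242"
  using zech_table_bounds by (auto simp: zech_def list_all_length)

text \<open>The identity \<open>x^(n+d) - x^n = x^n (x^d - 1)\<close>: linearity of
  \<open>step\<close> carries the table from \<open>n = 0\<close> to every \<open>n\<close>.\<close>

lemma diff3_lfsr:
  assumes d: "1 \<le> d" "d < 242"
  shows "diff3 (lfsr (n + d)) (lfsr n) = lfsr (n + zech d)"
proof -
  have len: "length (tl (states_from 242 start)) = 241" by (simp add: length_states_from)
  have i: "d - 1 < 241" using d by simp
  have "diff3 (tl (states_from 242 start) ! (d - 1)) start
      = map (\<lambda>v. diff3 v start) (tl (states_from 242 start)) ! (d - 1)"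
    using i len by simp
  also have "\<dots> = states_from 242 start ! (zech_table ! (d - 1))"
    unfolding zech_table_correct Let_def using i zech_table_bounds(2) by simp
  also have "\<dots> = lfsr (zech d)"
    using nth_states_from[of "zech d" 242 start] zech_less[OF d] by (simp add: lfsr_def zech_def)
  also have "tl (states_from 242 start) ! (d - 1) = states_from 242 start ! d"
    using d i len by (simp add: nth_tl)
  also have "\<dots> = lfsr d"
    using nth_states_from[of d 242 start] d by (simp add: lfsr_def)
  finally have "diff3 (lfsr d) (lfsr 0) = lfsr (zech d)" by (simp add: lfsr_def)
  then show ?thesis
    using diff3_lfsr_shift[of n d 0] by (simp add: lfsr_def funpow_add)
qed

lemma lfsr_valid: "lfsr n \<in> valid - {(0, 0, 0, 0, 0)}"
proof (induction n)
  case 0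
  show ?case by (simp add: lfsr_def start_def valid_def)
next
  case (Suc n)
  obtain a b c d e where s: "lfsr n = (a, b, c, d, e)" by (cases "lfsr n")
  have v: "a \<in> {0..<3}" "b \<in> {0..<3}" "c \<in> {0..<3}" "d \<in> {0..<3}" "e \<in> {0..<3}"
    and nz: "\<not> (a = 0 \<and> b = 0 \<and> c = 0 \<and> d = 0 \<and> e = 0)"
    using Suc s by (simp_all add: valid_def)
  \<comment> \<open>Since 2 is invertible modulo 3, vanishing of the feedback and of the kept
    coordinates would force the dropped coordinate \<open>a\<close> to vanish too.\<close>
  have "a = 0 \<or> a = 1 \<or> a = 2" using v(1) by auto
  then have "(2 * a + e) mod 3 = 0 \<and> e = 0 \<longrightarrow> a = 0"
    by (cases "e = 0") auto
  then have "\<not> (b = 0 \<and> c = 0 \<and> d = 0 \<and> e = 0 \<and> (2 * a + e) mod 3 = 0)" using nz by argo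
  moreover have "lfsr (Suc n) = (b, c, d, e, (2 * a + e) mod 3)" using s by (simp add: lfsr_def)
  ultimately show ?case using v by (simp add: valid_def)
qed

text \<open>If two powers within one period agreed, their difference zero would itself be a power by
  \<open>diff3_lfsr\<close>, contrary to \<open>lfsr_valid\<close>. So the period is exactly
  242.\<close>

lemma lfsr_eq_iff: "lfsr a = lfsr b \<longleftrightarrow> a mod 242 = b mod 242"
proof
  assume "a mod 242 = b mod 242"
  then show "lfsr a = lfsr b" using lfsr_mod by metis
next
  have lt: False if "lfsr a = lfsr b" "a < b" "b < 242" for a b
  proof -
    have "diff3 (lfsr b) (lfsr a) = lfsr (a + zech (b - a))"
      using diff3_lfsr[of "b - a" a] that by simp
    moreover have "diff3 s s = (0, 0, 0, 0, 0)" for s by (cases s) simp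
    ultimately show False using lfsr_valid[of "a + zech (b - a)"] that(1) by simp
  qed
  assume "lfsr a = lfsr b"
  then have "lfsr (a mod 242) = lfsr (b mod 242)" by (simp only: lfsr_mod)
  moreover have "a mod 242 < 242" "b mod 242 < 242" by simp_all
  ultimately show "a mod 242 = b mod 242" using lt by (metis linorder_neqE_nat)
qed

lemma vec_inj: "inj vec"
proof (rule injI)
  fix s t assume e: "vec s = vec t"
  obtain a b c d f a' b' c' d' f' where st: "s = (a, b, c, d, f)" "t = (a', b', c', d', f')"
    by (cases s; cases t)
  have "vec s i = vec t i" for i by (simp only: e)
  from this[of 1] this[of 2] this[of 3] this[of 4] this[of 5] show "s = t" by (simp add: st)
qed

lemma carrier_Z3: "carrier Z3_pow_5 = (\<Pi>\<^sub>E i\<in>{1..5}. {0..<3})"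
  by (simp add: Z3_pow_5_def carrier_integer_mod_group)

lemma finite_comm_group_Z3: "finite_comm_group Z3_pow_5"
proof -
  have "group Z3_pow_5" by (simp add: Z3_pow_5_def)
  moreover have "x \<otimes>\<^bsub>Z3_pow_5\<^esub> y = y \<otimes>\<^bsub>Z3_pow_5\<^esub> x" for x y
    by (simp add: Z3_pow_5_def add.commute)
  ultimately have "comm_group Z3_pow_5" by (simp add: group.group_comm_groupI)
  moreover have "finite (carrier Z3_pow_5)" by (simp add: carrier_Z3 finite_PiE)
  ultimately show ?thesis by (simp add: finite_comm_group_def finite_comm_group_axioms_def)
qed

lemma order_Z3: "order Z3_pow_5 = 243"
  by (simp add: order_def carrier_Z3 card_PiE)

lemma vec_carrier: "s \<in> valid \<Longrightarrow> vec s \<in> carrier Z3_pow_5"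
  by (cases s) (auto simp: carrier_Z3 valid_def PiE_def)

lemma vec_zero: "vec (0, 0, 0, 0, 0) = \<one>\<^bsub>Z3_pow_5\<^esub>"
  by (auto simp: Z3_pow_5_def)

lemma vec_diff:
  assumes s: "s \<in> valid" and t: "t \<in> valid"
  shows "inv\<^bsub>Z3_pow_5\<^esub> vec s \<otimes>\<^bsub>Z3_pow_5\<^esub> vec t = vec (diff3 t s)"
proof -
  interpret finite_comm_group Z3_pow_5 by (rule finite_comm_group_Z3)
  have d: "diff3 t s \<in> valid" by (cases s; cases t) (simp add: valid_def)
  obtain a b c d f a' b' c' d' f' where st: "s = (a, b, c, d, f)" "t = (a', b', c', d', f')"
    by (cases s; cases t)
  have t': "a' mod 3 = a'" "b' mod 3 = b'" "c' mod 3 = c'" "d' mod 3 = d'" "f' mod 3 = f'"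
    using t by (simp_all add: st valid_def)
  have "vec s \<otimes>\<^bsub>Z3_pow_5\<^esub> vec (diff3 t s) = (\<lambda>i\<in>{1..5}. (vec s i + vec (diff3 t s) i) mod 3)"
    by (simp add: Z3_pow_5_def)
  also have "\<dots> = (\<lambda>i\<in>{1..5}. vec t i)"
  proof (rule restrict_ext)
    fix i :: nat assume "i \<in> {1..5}"
    then have "i = 1 \<or> i = 2 \<or> i = 3 \<or> i = 4 \<or> i = 5" by auto
    then show "(vec s i + vec (diff3 t s) i) mod 3 = vec t i"
      by (elim disjE) (simp_all add: st t' mod_simps)
  qed
  also have "\<dots> = vec t" unfolding st vec.simps by (rule restrict_ext) simp
  finally have "vec s \<otimes>\<^bsub>Z3_pow_5\<^esub> vec (diff3 t s) = vec t" .
  then show ?thesis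
    using inv_solve_left[OF vec_carrier[OF d] vec_carrier[OF s] vec_carrier[OF t]] by simp
qed

section \<open>Cyclotomic classes of order 11\<close>

definition point :: "nat \<Rightarrow> nat \<Rightarrow> int" where "point n = vec (lfsr n)"

text \<open>A coset of the group of 11th powers. Reducing \<open>j\<close> lets the index 11 in
  \<open>{1..11}\<close> stand for the class of 0.\<close>

definition cyclotomic :: "nat \<Rightarrow> (nat \<Rightarrow> int) set"
  where "cyclotomic j = point ` {n. n mod 11 = j mod 11}"

lemma point_eq_iff: "point a = point b \<longleftrightarrow> a mod 242 = b mod 242"
  by (simp add: point_def inj_eq[OF vec_inj] lfsr_eq_iff)

text \<open>Since 11 divides the period 242, a point determines its exponent modulo 11.\<close>

lemma point_mem_cyclotomic: "point n \<in> cyclotomic j \<longleftrightarrow> n mod 11 = j mod 11"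
proof
  assume "point n \<in> cyclotomic j"
  then obtain n' where "n mod 242 = n' mod 242" "n' mod 11 = j mod 11"
    by (auto simp: cyclotomic_def point_eq_iff)
  moreover have "n mod 242 mod 11 = n mod 11" for n :: nat by (rule mod_mod_cancel) simp
  ultimately show "n mod 11 = j mod 11" by metis
qed (auto simp: cyclotomic_def)

lemma point_carrier: "point n \<in> carrier Z3_pow_5 - {\<one>\<^bsub>Z3_pow_5\<^esub>}"
  using vec_carrier lfsr_valid[of n] inj_eq[OF vec_inj] unfolding point_def vec_zero[symmetric] by blast

lemma point_quotient:
  assumes "1 \<le> d" "d < 242"
  shows "inv\<^bsub>Z3_pow_5\<^esub> point n \<otimes>\<^bsub>Z3_pow_5\<^esub> point (n + d) = point (n + zech d)"
  using vec_diff[of "lfsr n" "lfsr (n + d)"] lfsr_valid diff3_lfsr[OF assms] by (simp add: point_def)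

lemma point_surj: "point ` {..<242} = carrier Z3_pow_5 - {\<one>\<^bsub>Z3_pow_5\<^esub>}"
proof (rule card_subset_eq)
  interpret finite_comm_group Z3_pow_5 by (rule finite_comm_group_Z3)
  show "finite (carrier Z3_pow_5 - {\<one>\<^bsub>Z3_pow_5\<^esub>})" by simp
  show "point ` {..<242} \<subseteq> carrier Z3_pow_5 - {\<one>\<^bsub>Z3_pow_5\<^esub>}"
    by (rule image_subsetI) (rule point_carrier)
  have "inj_on point {..<242}" by (rule inj_onI) (simp add: point_eq_iff)
  then show "card (point ` {..<242}) = card (carrier Z3_pow_5 - {\<one>\<^bsub>Z3_pow_5\<^esub>})"
    using order_Z3 by (simp add: card_image order_def)
qed

lemma card_cyclotomic: "card (cyclotomic j) = 22"
proof -
  have "cyclotomic j = (\<lambda>t. point (11 * t + j mod 11)) ` {..<22}"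
  proof
    show "(\<lambda>t. point (11 * t + j mod 11)) ` {..<22} \<subseteq> cyclotomic j"
      by (auto simp: point_mem_cyclotomic)
    show "cyclotomic j \<subseteq> (\<lambda>t. point (11 * t + j mod 11)) ` {..<22}"
    proof
      fix x assume "x \<in> cyclotomic j"
      then obtain n where n: "x = point n" "n mod 11 = j mod 11" by (auto simp: cyclotomic_def)
      define t where "t = (n mod 242) div 11"
      have "n mod 242 mod 11 = n mod 11" by (rule mod_mod_cancel) simp
      moreover have "n mod 242 = 11 * t + n mod 242 mod 11" unfolding t_def by simp
      ultimately have t: "n mod 242 = 11 * t + j mod 11" using n(2) by simp
      have "n mod 242 < 242" by simp
      then have "t < 22" unfolding t_def by simp
      moreover have "x = point (11 * t + j mod 11)" unfolding n(1) t[symmetric] by (simp add: point_eq_iff)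
      ultimately show "x \<in> (\<lambda>t. point (11 * t + j mod 11)) ` {..<22}" by blast
    qed
  qed
  moreover have "inj_on (\<lambda>t. point (11 * t + j mod 11)) {..<22}"
  proof (rule inj_onI)
    fix s t :: nat assume st: "s \<in> {..<22}" "t \<in> {..<22}" "point (11 * s + j mod 11) = point (11 * t + j mod 11)"
    have "j mod 11 < 11" by simp
    then have "11 * s + j mod 11 < 242" "11 * t + j mod 11 < 242" using st(1,2) by auto
    then show "s = t" using st(3) by (simp add: point_eq_iff)
  qed
  ultimately show ?thesis by (simp add: card_image)
qed

lemma zech_hit_count:
  assumes "r < 11"
  shows "card {d \<in> {1..<242}. d mod 11 = r \<and> zech d mod 11 = r} = (if r = 0 then 1 else 2)"
proof -
  let ?Z = "filter (\<lambda>(d, z). d mod 11 = z mod 11) (zip [1..<242] zech_table)"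
  have mem: "(d, z) \<in> set (zip [1..<242] zech_table) \<longleftrightarrow> d \<in> {1..<242} \<and> z = zech d" for d z
  proof -
    have "(d, z) \<in> set (zip [1..<242] zech_table) \<longleftrightarrow> (\<exists>i<241. d = 1 + i \<and> z = zech_table ! i)"
    proof -
      have "(d, z) \<in> set (zip [1..<242] zech_table)
          \<longleftrightarrow> (\<exists>i<241. d = [1..<242] ! i \<and> z = zech_table ! i)"
        using zech_table_bounds(2) by (auto simp: set_zip)
      also have "\<dots> \<longleftrightarrow> (\<exists>i<241. d = 1 + i \<and> z = zech_table ! i)"
        by (intro ex_cong1 conj_cong) (simp_all add: nth_upt)
      finally show ?thesis .
    qed
    also have "\<dots> \<longleftrightarrow> d \<in> {1..<242} \<and> z = zech d"
      by (auto simp: zech_def intro!: exI[of _ "d - 1"])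
    finally show ?thesis .
  qed
  have "{d \<in> {1..<242}. d mod 11 = r \<and> zech d mod 11 = r} = fst ` {p \<in> set ?Z. fst p mod 11 = r}"
    using mem by (auto simp: image_iff)
  also have "\<dots> = set (map fst (filter (\<lambda>p. fst p mod 11 = r) ?Z))" by auto
  finally have "card {d \<in> {1..<242}. d mod 11 = r \<and> zech d mod 11 = r}
      = length (remdups (map fst (filter (\<lambda>p. fst p mod 11 = r) ?Z)))"
    by (simp only: length_remdups_card_conv)
  also have "\<dots> = (if r = 0 then 1 else 2)"
  proof -
    have "r \<in> {..<11}" using assms by simp
    then have "r \<in> {0, 1, 2, 3, 4, 5, 6, 7, 8, 9, 10}"
      by (auto simp: lessThan_nat_numeral simp del: lessThan_iff)
    then show ?thesis unfolding zech_hits by (elim insertE emptyE) simp_all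
  qed
  finally show ?thesis .
qed

text \<open>For \<open>x = point n\<close> write \<open>a = point (n + d)\<close>; then
  \<open>a - x\<close> is \<open>point (n + zech d)\<close>. Both lie in class \<open>j\<close> iff
  \<open>d\<close> and \<open>zech d\<close> are congruent to \<open>r = j - n\<close> modulo 11,
  and \<open>r = 0\<close> iff \<open>x\<close> is in class \<open>j\<close>. So
  \<open>zech_hit_count\<close> gives 1 on the class and 2 off it.\<close>

lemma sedf_Z3: "sedf Z3_pow_5 243 11 22 20 cyclotomic"
proof -
  interpret finite_comm_group Z3_pow_5 by (rule finite_comm_group_Z3)
  have un: "(\<Union>i\<in>{1..11}. cyclotomic i) = carrier Z3_pow_5 - {\<one>\<^bsub>Z3_pow_5\<^esub>}"
  proof
    show "(\<Union>i\<in>{1..11}. cyclotomic i) \<subseteq> carrier Z3_pow_5 - {\<one>\<^bsub>Z3_pow_5\<^esub>}"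
      unfolding cyclotomic_def by (intro UN_least image_subsetI point_carrier)
    show "carrier Z3_pow_5 - {\<one>\<^bsub>Z3_pow_5\<^esub>} \<subseteq> (\<Union>i\<in>{1..11}. cyclotomic i)"
    proof
      fix x assume "x \<in> carrier Z3_pow_5 - {\<one>\<^bsub>Z3_pow_5\<^esub>}"
      then obtain n where n: "x = point n" using point_surj by blast
      define i where "i = (if n mod 11 = 0 then 11 else n mod 11)"
      have "n mod 11 < 11" by simp
      then have "i \<in> {1..11}" "n mod 11 = i mod 11" by (auto simp: i_def)
      then show "x \<in> (\<Union>i\<in>{1..11}. cyclotomic i)" using n point_mem_cyclotomic by blast
    qed
  qed
  have disj: "disjoint_family_on cyclotomic {1..11}"
    unfolding disjoint_family_on_def
  proof (intro ballI impI)
    fix i j :: nat assume ij: "i \<in> {1..11}" "j \<in> {1..11}" "i \<noteq> j"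
    then have "i mod 11 \<noteq> j mod 11" by (cases "i = 11"; cases "j = 11") auto
    show "cyclotomic i \<inter> cyclotomic j = {}"
    proof (rule equals0I)
      fix x assume x: "x \<in> cyclotomic i \<inter> cyclotomic j"
      then obtain n where "x = point n" by (auto simp: cyclotomic_def)
      then show False using x \<open>i mod 11 \<noteq> j mod 11\<close> by (simp add: point_mem_cyclotomic)
    qed
  qed
  interpret nonidentity_partition Z3_pow_5 cyclotomic 11 22
    by unfold_locales (use un disj card_cyclotomic in auto)
  have "int (rep (cyclotomic j) (cyclotomic j) x)
      = (if x = \<one>\<^bsub>Z3_pow_5\<^esub> then int 20 else 0) + (int 22 - int 20) - (if x \<in> cyclotomic j then 1 else 0)"
    if j: "j \<in> {1..11}" and x: "x \<in> carrier Z3_pow_5" for j x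
  proof (cases "x = \<one>\<^bsub>Z3_pow_5\<^esub>")
    case True
    then show ?thesis using rep_one[OF D_subset[OF j]] card_cyclotomic one_notin_D[OF j] by simp
  next
    case False
    then have "x \<in> point ` {..<242}" unfolding point_surj using x by simp
    then obtain n where n: "x = point n" by blast
    \<comment> \<open>Modulo 11 the factor 10 is \<open>-1\<close>, which avoids natural
      subtraction.\<close>
    define r where "r = (j + 10 * n) mod 11"
    have r: "(n + d) mod 11 = j mod 11 \<longleftrightarrow> d mod 11 = r" for d
    proof
      assume "(n + d) mod 11 = j mod 11"
      then have "(10 * n + (n + d)) mod 11 = (10 * n + j) mod 11" by (metis mod_add_right_eq)
      moreover have "10 * n + (n + d) = d + n * 11" by simp
      ultimately have "(d + n * 11) mod 11 = (10 * n + j) mod 11" by (simp only:)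
      then show "d mod 11 = r" unfolding mod_mult_self1 by (simp only: r_def add.commute)
    next
      assume "d mod 11 = r"
      then have "d mod 11 = (j + 10 * n) mod 11" by (simp only: r_def)
      then have "(n + d) mod 11 = (n + (j + 10 * n)) mod 11" by (metis mod_add_right_eq)
      moreover have "n + (j + 10 * n) = j + n * 11" by simp
      ultimately have "(n + d) mod 11 = (j + n * 11) mod 11" by (simp only:)
      then show "(n + d) mod 11 = j mod 11" unfolding mod_mult_self1 .
    qed
    let ?H = "{d \<in> {1..<242}. d mod 11 = r \<and> zech d mod 11 = r}"
    have H: "point (n + d) \<in> cyclotomic j \<and> inv\<^bsub>Z3_pow_5\<^esub> x \<otimes>\<^bsub>Z3_pow_5\<^esub> point (n + d) \<in> cyclotomic j
        \<longleftrightarrow> d mod 11 = r \<and> zech d mod 11 = r" if "d \<in> {1..<242}" for d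
      using that unfolding n by (simp add: point_quotient point_mem_cyclotomic r)
    have "{a \<in> cyclotomic j. inv\<^bsub>Z3_pow_5\<^esub> x \<otimes>\<^bsub>Z3_pow_5\<^esub> a \<in> cyclotomic j} = (\<lambda>d. point (n + d)) ` ?H"
    proof
      show "(\<lambda>d. point (n + d)) ` ?H \<subseteq> {a \<in> cyclotomic j. inv\<^bsub>Z3_pow_5\<^esub> x \<otimes>\<^bsub>Z3_pow_5\<^esub> a \<in> cyclotomic j}"
        using H by blast
      show "{a \<in> cyclotomic j. inv\<^bsub>Z3_pow_5\<^esub> x \<otimes>\<^bsub>Z3_pow_5\<^esub> a \<in> cyclotomic j} \<subseteq> (\<lambda>d. point (n + d)) ` ?H"
      proof
        fix a assume "a \<in> {a \<in> cyclotomic j. inv\<^bsub>Z3_pow_5\<^esub> x \<otimes>\<^bsub>Z3_pow_5\<^esub> a \<in> cyclotomic j}"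
        then have a: "a \<in> cyclotomic j" "inv\<^bsub>Z3_pow_5\<^esub> x \<otimes>\<^bsub>Z3_pow_5\<^esub> a \<in> cyclotomic j" by auto
        from a(1) obtain p where p: "a = point p" by (auto simp: cyclotomic_def)
        \<comment> \<open>Here 241 plays the part of \<open>-1\<close> modulo 242, so
          \<open>d\<close> represents \<open>p - n\<close>.\<close>
        define d where "d = (p + 241 * n) mod 242"
        have "(n + d) mod 242 = (p + n * 242) mod 242"
          unfolding d_def mod_add_right_eq by (simp add: algebra_simps)
        then have "(n + d) mod 242 = p mod 242" by simp
        then have ad: "a = point (n + d)" unfolding p by (simp add: point_eq_iff)
        have "d \<noteq> 0"
        proof
          assume "d = 0"
          then have "a = x" using ad n by simp
          then have "inv\<^bsub>Z3_pow_5\<^esub> x \<otimes>\<^bsub>Z3_pow_5\<^esub> a = \<one>\<^bsub>Z3_pow_5\<^esub>" using x l_inv by simp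
          then show False using a(2) one_notin_D[OF j] by simp
        qed
        moreover have "d < 242" by (simp add: d_def)
        ultimately have "d \<in> {1..<242}" by simp
        then show "a \<in> (\<lambda>d. point (n + d)) ` ?H" using H[of d] a ad by blast
      qed
    qed
    moreover have "inj_on (\<lambda>d. point (n + d)) ?H"
    proof (rule inj_onI)
      fix d e assume de: "d \<in> ?H" "e \<in> ?H" "point (n + d) = point (n + e)"
      then have "(n + d) mod 242 = (n + e) mod 242" by (simp add: point_eq_iff)
      then have "(241 * n + (n + d)) mod 242 = (241 * n + (n + e)) mod 242"
        by (metis mod_add_right_eq)
      moreover have "(241 * n + (n + c)) mod 242 = c mod 242" for c
      proof -
        have "241 * n + (n + c) = c + n * 242" by simp
        then show ?thesis by (simp only: mod_mult_self1)
      qed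
      ultimately have "d mod 242 = e mod 242" by simp
      then show "d = e" using de(1,2) by simp
    qed
    ultimately have "rep (cyclotomic j) (cyclotomic j) x = card ?H" by (simp add: rep_def card_image)
    also have "\<dots> = (if r = 0 then 1 else 2)" by (rule zech_hit_count) (simp add: r_def)
    also have "r = 0 \<longleftrightarrow> x \<in> cyclotomic j"
      using r[of 0] unfolding n by (auto simp: point_mem_cyclotomic)
    finally show ?thesis using False by simp
  qed
  then show ?thesis using sedf_iff[of 20] order_Z3 by simp
qed

theorem theorem3p1:
  fixes G :: "('a, 'b) monoid_scheme" and v m k l :: nat and D :: "nat \<Rightarrow> 'a set"
  shows
    "(comm_group G \<and> finite (carrier G) \<and> order G = v \<and> v = k * m + 1 \<and>
      m \<ge> 2 \<and> k > 1 \<and> l > 0 \<and>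
      (\<Union>i\<in>{1..m}. D i) = carrier G - {\<one>\<^bsub>G\<^esub>} \<and>
      disjoint_family_on D {1..m} \<and> (\<forall>i\<in>{1..m}. card (D i) = k)
      \<longrightarrow>
      (nontrivial_sedf G v m k l D \<and> near_complete_sedf G v m k l D \<longleftrightarrow>
        ((v, m, k, l) = (v, 2, (v - 1) div 2, (v - 1) div 4) \<and> v mod 4 = 1 \<and>
          nontrivial_regular_pds G v ((v - 1) div 2) ((v - 5) div 4) ((v - 1) div 4) (D 1))
        \<or>
        ((v, m, k, l) = (243, 11, 22, 20) \<and>
          (\<forall>j\<in>{1..11}. nontrivial_regular_pds G 243 22 1 2 (D j)))))
     \<and> (\<exists>E. sedf Z3_pow_5 243 11 22 20 E)"
proof (rule conjI, intro impI, elim conjE)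
  assume G: "comm_group G" "finite (carrier G)" "order G = v" "m \<ge> 2" "k > 1" "l > 0"
    and D: "(\<Union>i\<in>{1..m}. D i) = carrier G - {\<one>\<^bsub>G\<^esub>}" "disjoint_family_on D {1..m}"
      "\<forall>i\<in>{1..m}. card (D i) = k"
  have "finite_comm_group G"
    by (intro finite_comm_group.intro finite_comm_group_axioms.intro G)
  then have "nonidentity_partition G D m k"
    using D G by (intro nonidentity_partition.intro nonidentity_partition_axioms.intro) blast+
  from nonidentity_partition.sedf_iff_pds[OF this G(6,3)]
  show "nontrivial_sedf G v m k l D \<and> near_complete_sedf G v m k l D \<longleftrightarrow>
    ((v, m, k, l) = (v, 2, (v - 1) div 2, (v - 1) div 4) \<and> v mod 4 = 1 \<and>
      nontrivial_regular_pds G v ((v - 1) div 2) ((v - 5) div 4) ((v - 1) div 4) (D 1))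
    \<or> ((v, m, k, l) = (243, 11, 22, 20) \<and>
      (\<forall>j\<in>{1..11}. nontrivial_regular_pds G 243 22 1 2 (D j)))" .
next
  show "\<exists>E. sedf Z3_pow_5 243 11 22 20 E" using sedf_Z3 by blast
qed

end
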